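(* Let $(\mathbf{a},\mathbf{b})\in W$ and let $q_0,q_1>1$ be real. (i) If $\pi_{\beta,\beta}(\mathbf{a})<\pi_{\beta,\beta}(\mathbf{b})$ for all $\beta>1$, then $h(\Omega_{\mathbf{a},\mathbf{b}})=0=\dim_H\pi_{q_0,q_1}(\Omega_{\mathbf{a},\mathbf{b}})$. (ii) Otherwise, $h(\Omega_{\mathbf{a},\mathbf{b}})=\log\beta$ for the maximal $\beta>1$ such that $\pi_{\beta,\beta}(\mathbf{a})=\pi_{\beta,\beta}(\mathbf{b})$, and $\dim_H\pi_{q_0,q_1}(\Omega_{\mathbf{a},\mathbf{b}})=\min\{1,s\}$ for the maximal $s>0$ such that $\pi_{q_0^s,q_1^s}(\mathbf{a})=\pi_{q_0^s,q_1^s}(\mathbf{b})$.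
   Context: For real $q_0,q_1>1$ and $i_1i_2\cdots\in\{0,1\}^\infty$, put $\pi_{q_0,q_1}(i_1i_2\cdots):=\sum_{k=1}^\infty \frac{i_k}{q_{i_1}\cdots q_{i_k}}$. $\prec$ is the lexicographic order on $\{0,1\}^\infty$, $]\mathbf{a},\mathbf{b}[:=\{\mathbf{u}\in\{0,1\}^\infty:\mathbf{a}\prec\mathbf{u}\prec\mathbf{b}\}$, and $\Omega_{\mathbf{a},\mathbf{b}}:=\{i_1i_2\cdots\in\{0,1\}^\infty: i_ni_{n+1}\cdots\notin{]\mathbf{a},\mathbf{b}[}\text{ for all }n\ge1\}$. The set of admissible pairs is $W:=\{(\mathbf{a},\mathbf{b})\in 0\{0,1\}^\infty\times1\{0,1\}^\infty:\mathbf{a},\mathbf{b}\in\Omega_{\mathbf{a},\mathbf{b}}\}$, where $0\{0,1\}^\infty$, $1\{0,1\}^\infty$ are the sets of infinite binary sequences starting with $0$, resp. $1$. The topological entropy is $h(\Omega_{\mathbf{a},\mathbf{b}})=\lim_{n\to\infty}\frac1n\log\#\{i_1\cdots i_n: i_1i_2\cdots\in\Omega_{\mathbf{a},\mathbf{b}}\}$. $\dim_H$ is Hausdorff dimension. *)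

theory Defs
  imports "HOL-Analysis.Analysis" "HOL-Library.Fun_Lexorder"
begin

(* Infinite binary sequences i_1 i_2 ... are functions nat => bool, with False for the digit 0
   and True for the digit 1; the digit i_k sits at position k - 1.  As False < True, less_fun
   is the lexicographic order on them. *)
type_synonym binseq = "nat \<Rightarrow> bool"

definition shift :: "nat \<Rightarrow> binseq \<Rightarrow> binseq" where
  "shift n u = (\<lambda>k. u (n + k))"

definition double_base_expansion :: "real \<Rightarrow> real \<Rightarrow> binseq \<Rightarrow> real" where
  "double_base_expansion q0 q1 u =
     (\<Sum>k. of_bool (u k) / (\<Prod>j\<le>k. if u j then q1 else q0))"

definition lex_interval :: "binseq \<Rightarrow> binseq \<Rightarrow> binseq set" where
  "lex_interval a b = {u. less_fun a u \<and> less_fun u b}"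

definition Omega :: "binseq \<Rightarrow> binseq \<Rightarrow> binseq set" where
  "Omega a b = {u. \<forall>n. shift n u \<notin> lex_interval a b}"

definition admissible_pairs :: "(binseq \<times> binseq) set" where
  "admissible_pairs = {(a, b). \<not> a 0 \<and> b 0 \<and> a \<in> Omega a b \<and> b \<in> Omega a b}"

definition prefixes :: "binseq set \<Rightarrow> nat \<Rightarrow> bool list set" where
  "prefixes X n = (\<lambda>u. map u [0..<n]) ` X"

(* A relation rather than a function, so that stating a value for the entropy
   includes the existence of the limit. *)
definition has_topological_entropy :: "binseq set \<Rightarrow> real \<Rightarrow> bool" where
  "has_topological_entropy X h \<longleftrightarrow>
     (\<lambda>n. ln (real (card (prefixes X n))) / real n) \<longlonglongrightarrow> h"

(* |U|^s with the conventions |{}|^s = 0, and |U|^0 = 1 for nonempty U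
   (note that 0 powr 0 = 0 in the library). *)
definition diam_powr :: "'a::metric_space set \<Rightarrow> real \<Rightarrow> real" where
  "diam_powr U s = (if U = {} then 0 else if s = 0 then 1 else diameter U powr s)"

(* Boundedness is required explicitly because diameter is unspecified on unbounded sets. *)
definition hausdorff_pre_measure :: "real \<Rightarrow> real \<Rightarrow> 'a::metric_space set \<Rightarrow> ennreal" where
  "hausdorff_pre_measure s \<delta> A =
     (INF U \<in> {U :: nat \<Rightarrow> 'a set. A \<subseteq> (\<Union>i. U i) \<and> (\<forall>i. bounded (U i) \<and> diameter (U i) \<le> \<delta>)}.
        (\<Sum>i. ennreal (diam_powr (U i) s)))"

definition hausdorff_measure :: "real \<Rightarrow> 'a::metric_space set \<Rightarrow> ennreal" where
  "hausdorff_measure s A = (SUP \<delta> \<in> {0<..}. hausdorff_pre_measure s \<delta> A)"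

definition hausdorff_dim :: "'a::metric_space set \<Rightarrow> ereal" where
  "hausdorff_dim A = (INF s \<in> {s. 0 \<le> s \<and> hausdorff_measure s A = 0}. ereal s)"

end

theory Submission
  imports Defs
begin

text \<open>Write \<open>X\<close> for \<open>Omega a b\<close> and \<open>\<pi>\<^sub>r\<close> for the expansion in the bases \<open>q0\<close>, \<open>q1\<close> raised to the
power \<open>r\<close>.  A finite word has a weight: the product of the inverse bases of its digits, and passing
from exponent \<open>1\<close> to exponent \<open>r\<close> raises all weights to the power \<open>r\<close>.  Both the entropy of \<open>X\<close> and the
dimension of its image are governed by the exponent at which the total weight of the words of
length \<open>n\<close> that occur in \<open>X\<close> turns from growing to decaying.  The point is to recognise that exponent
as the largest zero of \<open>\<pi>\<^sub>r(b) - \<pi>\<^sub>r(a)\<close>.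

The key is a dichotomy for an arbitrary pair of bases (\<open>separated_or_covering\<close>).  Either the
expansion is \<^emph>\<open>separated\<close>: it puts the sequences of \<open>X\<close> starting with \<open>0\<close> to the left of those
starting with \<open>1\<close>, with a positive gap in between.  Or it is \<^emph>\<open>covering\<close>: it maps \<open>X\<close> onto the whole
interval of numbers that have an expansion.  To see this, choose a threshold \<open>c\<close> and expand numbers
by taking the digit \<open>0\<close> below \<open>c\<close> and \<open>1\<close> above \<open>c\<close>.  The two expansions \<open>l\<close> and \<open>u\<close> of \<open>c\<close> itself that
start with \<open>0\<close> and \<open>1\<close> bound all sequences so obtained.  If \<open>l \<le> a\<close> and \<open>b \<le> u\<close>, these sequences lie in
\<open>X\<close>, and they already expand every number.  If \<open>a \<le> l\<close> and \<open>u \<le> b\<close> and not both are equalities, then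
\<open>c\<close> separates the two halves of \<open>X\<close>.  One of these cases occurs at or next to the supremum of
the \<open>c\<close> with \<open>l \<le> a\<close>, by the one-sided continuity of \<open>l\<close> and \<open>u\<close> in \<open>c\<close>.  (If the bases are so large that
no threshold exists, the two halves are separated even in the full shift.)

The two alternatives are told apart by the weight sums.  If the expansion is separated, then every
branching word causes a gap proportional to its weight, the gaps are disjoint, and so the total
weight of the words of length \<open>n\<close> stays bounded (\<open>separated_weight_sum_bounded\<close>).  If it is covering,
then the images of the words of length \<open>n\<close> cover an interval, and their total weight is bounded below
(\<open>covering_weight_sum_ge\<close>).  Raising the exponent multiplies the weights by an exponentially small
factor, so no exponent above a separated one can be covering.  Since separation is moreover an open
condition on the exponent, there is a critical exponent \<open>s\<close> such that \<open>\<pi>\<^sub>r\<close> is covering for \<open>r \<le> s\<close> and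
separated for \<open>r > s\<close> (\<open>critical_exponent\<close>), or else \<open>\<pi>\<^sub>r\<close> is separated for all \<open>r > 0\<close>.  For \<open>r > s\<close>
separation gives \<open>\<pi>\<^sub>r(a) < \<pi>\<^sub>r(b)\<close>.  In the limit \<open>\<pi>\<^sub>s(a) \<le> \<pi>\<^sub>s(b)\<close>, and a strict inequality would
make \<open>\<pi>\<^sub>s\<close> separated; so \<open>s\<close> is the largest zero.

Whether there is a critical exponent does not depend on the bases (\<open>separated_all_not_covering\<close>): the weights for
two pairs of bases can be compared at suitable exponents.  Hence the two cases of the theorem, which
are told apart by equal bases, also decide the existence of a zero \<open>s\<close> for the bases \<open>q0\<close>, \<open>q1\<close>.

In base \<open>e\<close> the weight sum at exponent \<open>r\<close> is the number of words divided by \<open>exp (r n)\<close>, which yields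
the entropy.  For the dimension in the bases \<open>q0\<close>, \<open>q1\<close>, cylinders give efficient covers for every
exponent above \<open>s\<close>.  If \<open>s < 1\<close>, then \<open>\<pi>\<^sub>1\<close> is separated, and the map \<open>\<pi>\<^sub>1(u) \<mapsto> \<pi>\<^sub>s(u)\<close> is Hoelder
continuous of exponent \<open>s\<close> and maps the image of \<open>X\<close> onto an interval, which bounds the dimension from
below by \<open>s\<close>.  If \<open>s \<ge> 1\<close>, then \<open>\<pi>\<^sub>1\<close> is covering, and the image of \<open>X\<close> is itself an interval.\<close>

text \<open>A bounded quantity that is at most a fixed fraction of its positive part elsewhere, up to an error
\<open>e\<close>, is at most \<open>e / (1 - \<rho>)\<close>: iterate.  All estimates on expansions that follow from the behaviour of
their tails are instances, with \<open>f\<close> the violation of the estimate.\<close>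
lemma contraction_bound:
  fixes f :: "'a \<Rightarrow> real"
  assumes \<rho>: "0 \<le> \<rho>" "\<rho> < 1" and e: "0 \<le> e"
    and bound: "\<And>u. u \<in> X \<Longrightarrow> f u \<le> B"
    and contr: "\<And>u. u \<in> X \<Longrightarrow> \<exists>v\<in>X. f u \<le> \<rho> * max 0 (f v) + e"
    and u: "u \<in> X"
  shows "f u \<le> e / (1 - \<rho>)"
proof -
  have approx: "f u \<le> \<rho> ^ n * max 0 B + e / (1 - \<rho>)" if "u \<in> X" for n u
    using that
  proof (induction n arbitrary: u)
    case 0
    then show ?case using bound[OF 0] e \<rho> by (simp add: add_increasing2)
  next
    case (Suc n)
    obtain v where v: "v \<in> X" "f u \<le> \<rho> * max 0 (f v) + e" using contr[OF Suc.prems] by blast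
    have "max 0 (f v) \<le> \<rho> ^ n * max 0 B + e / (1 - \<rho>)"
      using Suc.IH[OF v(1)] e \<rho> by simp
    then have "\<rho> * max 0 (f v) \<le> \<rho> * (\<rho> ^ n * max 0 B + e / (1 - \<rho>))"
      using \<rho>(1) by (rule mult_left_mono)
    moreover have "\<rho> * (e / (1 - \<rho>)) + e = e / (1 - \<rho>)"
      using \<rho> by (simp add: field_simps)
    ultimately show ?case using v(2) by (simp add: algebra_simps)
  qed
  have "(\<lambda>n. \<rho> ^ n * max 0 B + e / (1 - \<rho>)) \<longlonglongrightarrow> 0 * max 0 B + e / (1 - \<rho>)"
    using \<rho> by (intro tendsto_intros) auto
  then show ?thesis
    using approx[OF u] by (intro LIMSEQ_le_const[where a = "f u"]) (auto simp del: mult_zero_left)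
qed

section \<open>Binary sequences and the lexicographic order\<close>

lemma shift_apply [simp]: "shift n u k = u (n + k)"
  by (simp add: shift_def)

lemma shift_0 [simp]: "shift 0 u = u"
  by (simp add: shift_def)

lemma shift_shift [simp]: "shift m (shift n u) = shift (n + m) u"
  by (simp add: shift_def add.assoc)

lemma less_fun_bool:
  "less_fun u v \<longleftrightarrow> (\<exists>n. \<not> u n \<and> v n \<and> (\<forall>k<n. u k = v k))" for u v :: binseq
  unfolding less_fun_def by (auto simp: less_bool_def)

lemma less_fun_linear: "u = v \<or> less_fun u v \<or> less_fun v u" for u v :: binseq
proof (cases "u = v")
  case False
  then obtain m where "u m \<noteq> v m" by auto
  then have "u (LEAST m. u m \<noteq> v m) \<noteq> v (LEAST m. u m \<noteq> v m)" by (rule LeastI)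
  moreover have "\<forall>k<(LEAST m. u m \<noteq> v m). u k = v k" using not_less_Least by blast
  ultimately show ?thesis unfolding less_fun_bool by (metis (full_types))
qed simp

lemma less_fun_le_trans:
  fixes u v w :: binseq
  shows "\<not> less_fun u v \<Longrightarrow> less_fun u w \<Longrightarrow> less_fun v w"
    and "\<not> less_fun v w \<Longrightarrow> less_fun u w \<Longrightarrow> less_fun u v"
  using less_fun_linear[of u v] less_fun_linear[of v w] less_fun_trans[of v u w] less_fun_trans[of u w v]
  by auto

section \<open>Expansions in two bases\<close>

definition word_weight :: "real \<Rightarrow> real \<Rightarrow> bool list \<Rightarrow> real" where
  "word_weight p0 p1 w = (\<Prod>d\<leftarrow>w. 1 / (if d then p1 else p0))"

abbreviation prefix_of :: "binseq \<Rightarrow> nat \<Rightarrow> bool list" where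
  "prefix_of u n \<equiv> map u [0..<n]"

lemma prefix_of_eq_iff: "prefix_of u n = prefix_of v n \<longleftrightarrow> (\<forall>k<n. u k = v k)"
  by (auto simp: list_eq_iff_nth_eq)

locale two_bases =
  fixes p0 p1 :: real
  assumes p0: "1 < p0" and p1: "1 < p1"
begin

abbreviation val :: "binseq \<Rightarrow> real" where
  "val u \<equiv> double_base_expansion p0 p1 u"

abbreviation weight :: "bool list \<Rightarrow> real" where
  "weight w \<equiv> word_weight p0 p1 w"

text \<open>The value of the sequence \<open>111...\<close>, hence the largest value of an expansion.\<close>
definition vmax :: real where
  "vmax = 1 / (p1 - 1)"

definition ratio :: real where
  "ratio = max (1 / p0) (1 / p1)"

lemma vmax_pos: "0 < vmax" and vmax_fixed: "(1 + vmax) / p1 = vmax"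
  using p1 by (auto simp: vmax_def field_simps)

lemma ratio: "0 < ratio" "ratio < 1" "1 / p0 \<le> ratio" "1 / p1 \<le> ratio"
  using p0 p1 by (auto simp: ratio_def max_def)

lemma weight_Nil [simp]: "weight [] = 1"
  and weight_append [simp]: "weight (v @ w) = weight v * weight w"
  and weight_Cons [simp]: "weight (d # w) = weight w / (if d then p1 else p0)"
  by (simp_all add: word_weight_def)

lemma weight_pos: "0 < weight w"
  using p0 p1 by (induction w) auto

lemma weight_le_power: "weight w \<le> ratio ^ length w"
proof (induction w)
  case (Cons d w)
  have "weight (d # w) = (1 / (if d then p1 else p0)) * weight w" by simp
  also have "\<dots> \<le> ratio * ratio ^ length w"
    using Cons ratio weight_pos[of w] p0 p1 by (intro mult_mono) auto
  finally show ?case by simp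
qed simp

lemma weight_le_one: "weight w \<le> 1"
  using weight_le_power[of w] ratio power_le_one[of ratio "length w"] by linarith

lemma weight_le_ratio: "w \<noteq> [] \<Longrightarrow> weight w \<le> ratio"
  using weight_le_power[of w] ratio power_decreasing[of 1 "length w" ratio]
  by (auto simp: Suc_le_eq)

lemma weight_prefix: "weight (prefix_of u (Suc k)) = 1 / (\<Prod>j\<le>k. if u j then p1 else p0)"
proof (induction k)
  case (Suc k)
  have "prefix_of u (Suc (Suc k)) = prefix_of u (Suc k) @ [u (Suc k)]" by simp
  then show ?case using Suc by (simp del: upt_Suc)
qed auto

lemma val_terms: "of_bool (u k) / (\<Prod>j\<le>k. if u j then p1 else p0)
    = of_bool (u k) * weight (prefix_of u (Suc k))"
  by (simp only: weight_prefix) simp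

lemma val_terms_le: "\<bar>of_bool (u k) / (\<Prod>j\<le>k. if u j then p1 else p0)\<bar> \<le> ratio ^ Suc k"
  unfolding val_terms
  using weight_le_power[of "prefix_of u (Suc k)"] weight_pos[of "prefix_of u (Suc k)"] ratio
  by (cases "u k") (simp_all del: upt_Suc)

lemma val_summable: "summable (\<lambda>k. of_bool (u k) / (\<Prod>j\<le>k. if u j then p1 else p0))"
proof (rule summable_comparison_test')
  show "summable (\<lambda>k. ratio ^ Suc k)"
    using ratio by (subst summable_Suc_iff) (auto intro: summable_geometric)
qed (use val_terms_le in \<open>simp only: real_norm_def\<close>)

lemma val_nonneg: "0 \<le> val u"
  unfolding double_base_expansion_def
  by (intro suminf_nonneg val_summable) (use p0 p1 in \<open>auto intro!: divide_nonneg_nonneg prod_nonneg\<close>)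

lemma val_unfold:
  "val u = (if u 0 then (1 + val (shift 1 u)) / p1 else val (shift 1 u) / p0)"
proof -
  let ?q = "if u 0 then p1 else p0"
  let ?t = "\<lambda>u k. of_bool (u k) / (\<Prod>j\<le>k. if u j then p1 else p0)"
  have prod: "(\<Prod>j\<le>Suc k. if u j then p1 else p0)
      = ?q * (\<Prod>j\<le>k. if shift 1 u j then p1 else p0)" for k
    by (subst prod.atMost_Suc_shift) simp
  have "val u = ?t u 0 + (\<Sum>k. ?t u (Suc k))"
    unfolding double_base_expansion_def using suminf_split_head[OF val_summable[of u]] by simp
  also have "(\<lambda>k. ?t u (Suc k)) = (\<lambda>k. ?t (shift 1 u) k / ?q)"
    by (rule ext) (simp only: prod, simp)
  also have "(\<Sum>k. ?t (shift 1 u) k / ?q) = val (shift 1 u) / ?q"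
    unfolding double_base_expansion_def by (rule suminf_divide[OF val_summable])
  finally show ?thesis by (auto simp: add_divide_distrib)
qed

lemma val_le_vmax: "val u \<le> vmax"
proof -
  have "val u - vmax \<le> 0 / (1 - ratio)"
  proof (rule contraction_bound[where X = UNIV and f = "\<lambda>u. val u - vmax" and \<rho> = ratio])
    fix u :: binseq
    have "val u \<le> (\<Sum>k. ratio ^ Suc k)"
      unfolding double_base_expansion_def
      by (intro suminf_le val_summable order_trans[OF abs_ge_self val_terms_le])
         (use ratio in \<open>auto simp: summable_Suc_iff simp del: power_Suc\<close>)
    then show "val u - vmax \<le> (\<Sum>k. ratio ^ Suc k) - vmax" by simp
    let ?d = "val (shift 1 u) - vmax"
    have "val u - vmax \<le> (1 / (if u 0 then p1 else p0)) * ?d"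
    proof (cases "u 0")
      case True
      then show ?thesis using vmax_fixed val_unfold[of u]
        by (simp add: diff_divide_distrib add_divide_distrib)
    next
      case False
      have "vmax / p0 \<le> vmax" using vmax_pos p0 by (simp add: divide_le_eq mult_left_le)
      then show ?thesis using False val_unfold[of u]
        by (simp add: diff_divide_distrib)
    qed
    also have "\<dots> \<le> (1 / (if u 0 then p1 else p0)) * max 0 ?d"
      using p0 p1 by (intro mult_left_mono) auto
    also have "\<dots> \<le> ratio * max 0 ?d"
      using ratio by (intro mult_right_mono) auto
    finally show "\<exists>v\<in>UNIV. val u - vmax \<le> ratio * max 0 (val v - vmax) + 0" by auto
  qed (use ratio in auto)
  then show ?thesis by simp
qed

text \<open>Cancelling a common prefix is the self-similarity of the expansion; every comparison of two
sequences below goes through their first difference.\<close>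
lemma val_diff:
  assumes "\<And>k. k < n \<Longrightarrow> u k = v k"
  shows "val u - val v = weight (prefix_of u n) * (val (shift n u) - val (shift n v))"
  using assms
proof (induction n arbitrary: u v)
  case (Suc n)
  have "u 0 = v 0" using Suc.prems by blast
  then have "val u - val v = (val (shift 1 u) - val (shift 1 v)) / (if u 0 then p1 else p0)"
    using val_unfold[of u] val_unfold[of v] by (auto simp: diff_divide_distrib add_divide_distrib)
  also have "val (shift 1 u) - val (shift 1 v)
      = weight (prefix_of (shift 1 u) n) * (val (shift n (shift 1 u)) - val (shift n (shift 1 v)))"
    by (rule Suc.IH) (use Suc.prems in simp)
  finally have *: "val u - val v = weight (prefix_of (shift 1 u) n)
      * (val (shift n (shift 1 u)) - val (shift n (shift 1 v))) / (if u 0 then p1 else p0)"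
    by simp
  have "prefix_of u (Suc n) = u 0 # prefix_of (shift 1 u) n"
    by (simp add: map_upt_Suc del: upt_Suc)
  then show ?case using * by (simp del: upt_Suc shift_apply)
qed simp

lemma val_diff_prefix:
  assumes "prefix_of u n = prefix_of v n"
  shows "val u - val v = weight (prefix_of u n) * (val (shift n u) - val (shift n v))"
  using assms unfolding prefix_of_eq_iff by (intro val_diff) blast

lemma val_diff_le:
  assumes "prefix_of u n = prefix_of v n"
  shows "\<bar>val u - val v\<bar> \<le> weight (prefix_of u n) * vmax"
proof -
  have "\<bar>val (shift n u) - val (shift n v)\<bar> \<le> vmax"
    using val_nonneg[of "shift n u"] val_nonneg[of "shift n v"]
      val_le_vmax[of "shift n u"] val_le_vmax[of "shift n v"] by linarith
  then show ?thesis
    unfolding val_diff_prefix[OF assms]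
    using weight_pos[of "prefix_of u n"] by (simp add: abs_mult mult_left_mono)
qed

end

section \<open>Weight sums of separated and covering sets\<close>

definition shift_closed :: "binseq set \<Rightarrow> bool" where
  "shift_closed X \<longleftrightarrow> (\<forall>u\<in>X. \<forall>n. shift n u \<in> X)"

definition cylinder :: "binseq set \<Rightarrow> bool list \<Rightarrow> binseq set" where
  "cylinder X w = {u \<in> X. prefix_of u (length w) = w}"

lemma in_prefixes_iff: "w \<in> prefixes X n \<longleftrightarrow> length w = n \<and> cylinder X w \<noteq> {}"
proof
  assume "w \<in> prefixes X n"
  then obtain u where "u \<in> X" "w = prefix_of u n" by (auto simp only: prefixes_def)
  then have "length w = n" "u \<in> cylinder X w" by (auto simp: cylinder_def)
  then show "length w = n \<and> cylinder X w \<noteq> {}" by blast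
next
  assume "length w = n \<and> cylinder X w \<noteq> {}"
  then obtain u where "u \<in> X" "prefix_of u n = w" by (auto simp only: cylinder_def)
  then show "w \<in> prefixes X n" by (auto simp only: prefixes_def)
qed

lemma finite_prefixes [simp]: "finite (prefixes X n)"
  by (rule finite_subset[OF _ finite_lists_length_eq[of UNIV n]]) (auto simp: in_prefixes_iff)

lemma cylinder_snoc: "cylinder X (w @ [d]) = {u \<in> cylinder X w. u (length w) = d}"
  by (auto simp: cylinder_def)

lemma sum_bool_Collect:
  fixes f :: "bool \<Rightarrow> real"
  shows "P False \<Longrightarrow> P True \<Longrightarrow> (\<Sum>d | P d. f d) = f False + f True"
    and "P d \<Longrightarrow> \<not> P (\<not> d) \<Longrightarrow> (\<Sum>d | P d. f d) = f d"
proof -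
  assume "P False" "P True"
  then have "{d. P d} = {False, True}" by auto
  then show "(\<Sum>d | P d. f d) = f False + f True" by simp
next
  assume "P d" "\<not> P (\<not> d)"
  then have "P e \<longleftrightarrow> e = d" for e by (cases d; cases e) auto
  then show "(\<Sum>d | P d. f d) = f d" by simp
qed

lemma sum_prefixes_Suc:
  "(\<Sum>w\<in>prefixes X (Suc n). f w)
     = (\<Sum>w\<in>prefixes X n. \<Sum>d | cylinder X (w @ [d]) \<noteq> {}. f (w @ [d]))"
proof -
  let ?P = "SIGMA w:prefixes X n. {d. cylinder X (w @ [d]) \<noteq> {}}"
  have "prefixes X (Suc n) = (\<lambda>(w, d). w @ [d]) ` ?P"
  proof (intro equalityI subsetI)
    fix w assume w: "w \<in> prefixes X (Suc n)"
    then obtain w' d where "w = w' @ [d]"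
      by (cases w rule: rev_cases) (auto simp: in_prefixes_iff)
    with w show "w \<in> (\<lambda>(w, d). w @ [d]) ` ?P"
      by (auto simp: in_prefixes_iff cylinder_snoc intro!: image_eqI[of _ _ "(w', d)"])
  qed (auto simp: in_prefixes_iff cylinder_snoc)
  then have "(\<Sum>w\<in>prefixes X (Suc n). f w) = (\<Sum>(w, d)\<in>?P. f (w @ [d]))"
    by (simp add: sum.reindex inj_on_def case_prod_unfold prod_eq_iff)
  then show ?thesis by (simp add: sum.Sigma)
qed

context two_bases
begin

text \<open>The gap \<open>\<delta>\<close> is uniform so that the condition survives small changes of the bases.\<close>
definition separated :: "binseq set \<Rightarrow> bool" where
  "separated X \<longleftrightarrow> (\<exists>\<delta>>0. \<forall>u\<in>X. \<forall>v\<in>X. \<not> u 0 \<longrightarrow> v 0 \<longrightarrow> val u + \<delta> \<le> val v)"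

text \<open>The interval \<open>{0..vmax}\<close> contains the values of all sequences, so a covering set misses no value of the
full shift.\<close>
definition covering :: "binseq set \<Rightarrow> bool" where
  "covering X \<longleftrightarrow> {0..vmax} \<subseteq> val ` X"

definition weight_sum :: "binseq set \<Rightarrow> nat \<Rightarrow> real" where
  "weight_sum X n = (\<Sum>w\<in>prefixes X n. weight w)"

definition spread :: "binseq set \<Rightarrow> bool list \<Rightarrow> real" where
  "spread X w = Sup (val ` cylinder X w) - Inf (val ` cylinder X w)"

lemma weight_snoc_le: "weight (w @ [d]) \<le> weight w"
  unfolding weight_append using weight_pos[of w] weight_le_one[of "[d]"]
  by (intro mult_left_le) auto

lemma bdd_val: "bdd_above (val ` A)" "bdd_below (val ` A)"
  using val_nonneg val_le_vmax by (auto intro!: bdd_aboveI bdd_belowI)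

lemma spread_le:
  assumes "A \<noteq> {}" "A \<subseteq> B"
  shows "Sup (val ` A) \<le> Sup (val ` B)" "Inf (val ` B) \<le> Inf (val ` A)"
  using assms bdd_val by (auto intro!: cSup_subset_mono cInf_superset_mono)

text \<open>Scaled to a word \<open>w\<close> with two continuations, the gap between the halves of \<open>X\<close> leaves a hole of size
\<open>\<delta> * weight w\<close> between the images of the two subcylinders.\<close>
lemma spread_children:
  assumes X: "shift_closed X"
    and sep: "\<And>u v. u \<in> X \<Longrightarrow> v \<in> X \<Longrightarrow> \<not> u 0 \<Longrightarrow> v 0 \<Longrightarrow> val u + \<delta> \<le> val v"
    and both: "cylinder X (w @ [False]) \<noteq> {}" "cylinder X (w @ [True]) \<noteq> {}"
  shows "spread X (w @ [False]) + spread X (w @ [True]) + \<delta> * weight w \<le> spread X w"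
proof -
  let ?C = "\<lambda>d. val ` cylinder X (w @ [d])"
  have gap: "val u + \<delta> * weight w \<le> val v"
    if u: "u \<in> cylinder X (w @ [False])" and v: "v \<in> cylinder X (w @ [True])" for u v
  proof -
    let ?n = "length w"
    have agree: "prefix_of v ?n = prefix_of u ?n" "prefix_of v ?n = w" and "u \<in> X" "v \<in> X"
      and digits: "\<not> u ?n" "v ?n"
      using u v by (auto simp: cylinder_def)
    then have "val (shift ?n u) + \<delta> \<le> val (shift ?n v)"
      using X by (intro sep) (auto simp: shift_closed_def)
    then have "weight w * \<delta> \<le> weight w * (val (shift ?n v) - val (shift ?n u))"
      using weight_pos[of w] by (intro mult_left_mono) auto
    also have "\<dots> = val v - val u"
      using val_diff_prefix[OF agree(1)] unfolding agree(2) by simp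
    finally show ?thesis by (simp add: mult.commute)
  qed
  have "Sup (?C False) \<le> Inf (?C True) - \<delta> * weight w"
  proof (intro cSUP_least both)
    fix u assume "u \<in> cylinder X (w @ [False])"
    then have "val u + \<delta> * weight w \<le> Inf (?C True)"
      using gap both by (intro cINF_greatest) auto
    then show "val u \<le> Inf (?C True) - \<delta> * weight w" by simp
  qed
  moreover have "Sup (?C True) \<le> Sup (val ` cylinder X w)"
      "Inf (val ` cylinder X w) \<le> Inf (?C False)"
    using both by (auto intro!: spread_le simp: cylinder_snoc)
  ultimately show ?thesis by (simp add: spread_def)
qed

text \<open>A branching at \<open>w\<close> increases the total weight by at most \<open>weight w\<close>, and it uses up \<open>\<delta> * weight w\<close> of
the total spread.  Hence the sum of \<open>weight w + spread X w / \<delta>\<close> over the words of length \<open>n\<close> is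
nonincreasing in \<open>n\<close>.\<close>
theorem separated_weight_sum_bounded:
  assumes X: "shift_closed X" and sep: "separated X"
  obtains C where "0 < C" "\<And>n. weight_sum X n \<le> C"
proof -
  obtain \<delta> where \<delta>: "0 < \<delta>"
    and gap: "\<And>u v. u \<in> X \<Longrightarrow> v \<in> X \<Longrightarrow> \<not> u 0 \<Longrightarrow> v 0 \<Longrightarrow> val u + \<delta> \<le> val v"
    using sep unfolding separated_def by blast
  let ?g = "\<lambda>w. weight w + spread X w / \<delta>"
  have children: "(\<Sum>d | cylinder X (w @ [d]) \<noteq> {}. ?g (w @ [d])) \<le> ?g w"
    if w: "w \<in> prefixes X n" for w n
  proof -
    have one: "?g (w @ [d]) \<le> ?g w" if "cylinder X (w @ [d]) \<noteq> {}" for d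
    proof -
      have "spread X (w @ [d]) \<le> spread X w"
        using spread_le[of "cylinder X (w @ [d])" "cylinder X w"] that
        by (auto simp: spread_def cylinder_snoc)
      moreover have "weight (w @ [d]) \<le> weight w"
        by (rule weight_snoc_le)
      ultimately show ?thesis using \<delta> by (intro add_mono divide_right_mono) auto
    qed
    obtain u where "u \<in> cylinder X w" using w by (auto simp only: in_prefixes_iff)
    then have "cylinder X (w @ [u (length w)]) \<noteq> {}" by (auto simp: cylinder_snoc)
    then consider "cylinder X (w @ [False]) \<noteq> {}" "cylinder X (w @ [True]) \<noteq> {}"
      | d where "cylinder X (w @ [d]) \<noteq> {}" "\<not> cylinder X (w @ [\<not> d]) \<noteq> {}"
      by (metis (full_types))
    then show ?thesis
    proof cases
      case 1
      from spread_children[OF X gap this]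
      have "(spread X (w @ [False]) + spread X (w @ [True]) + \<delta> * weight w) / \<delta> \<le> spread X w / \<delta>"
        using \<delta> by (intro divide_right_mono) auto
      then have "spread X (w @ [False]) / \<delta> + spread X (w @ [True]) / \<delta> + weight w \<le> spread X w / \<delta>"
        using \<delta> by (simp add: add_divide_distrib)
      moreover have "weight (w @ [False]) + weight (w @ [True]) \<le> weight w + weight w"
        by (intro add_mono weight_snoc_le)
      ultimately show ?thesis unfolding sum_bool_Collect(1)[of "\<lambda>d. cylinder X (w @ [d]) \<noteq> {}", OF 1]
        by linarith
    next
      case (2 d)
      show ?thesis
        unfolding sum_bool_Collect(2)[of "\<lambda>d. cylinder X (w @ [d]) \<noteq> {}", OF 2]
        using one 2 by blast
    qed
  qed
  have total: "(\<Sum>w\<in>prefixes X n. ?g w) \<le> 1 + vmax / \<delta>" for n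
  proof (induction n)
    case 0
    show ?case
    proof (cases "X = {}")
      case True
      then show ?thesis using vmax_pos \<delta> by (simp add: prefixes_def)
    next
      case False
      then have "prefixes X 0 = {[]}" by (auto simp: prefixes_def)
      moreover have "spread X [] \<le> vmax"
      proof -
        have ne: "cylinder X [] \<noteq> {}" using False by (simp add: cylinder_def)
        have "Sup (val ` cylinder X []) \<le> vmax" "0 \<le> Inf (val ` cylinder X [])"
          using ne val_le_vmax val_nonneg by (auto intro!: cSUP_least cINF_greatest)
        then show ?thesis by (simp add: spread_def)
      qed
      ultimately show ?thesis using \<delta> by (simp add: divide_right_mono)
    qed
  next
    case (Suc n)
    have "(\<Sum>w\<in>prefixes X (Suc n). ?g w) \<le> (\<Sum>w\<in>prefixes X n. ?g w)"
      unfolding sum_prefixes_Suc by (intro sum_mono children)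
    then show ?case using Suc by linarith
  qed
  have "weight_sum X n \<le> 1 + vmax / \<delta>" for n
  proof -
    have "weight w \<le> ?g w" if "w \<in> prefixes X n" for w
    proof -
      have "0 \<le> spread X w"
        unfolding spread_def using that bdd_val
        by (auto simp: in_prefixes_iff intro!: cInf_le_cSup)
      then show ?thesis using \<delta> by simp
    qed
    then show ?thesis using total[of n] sum_mono[of "prefixes X n" weight ?g]
      by (simp add: weight_sum_def)
  qed
  moreover have "0 < 1 + vmax / \<delta>" using vmax_pos \<delta> by (simp add: add_pos_pos)
  ultimately show thesis using that by blast
qed

text \<open>The image of a cylinder lies in an interval of length \<open>2 * weight w * vmax\<close> centred at one of its
points, and these intervals together cover \<open>{0..vmax}\<close>.\<close>
theorem covering_weight_sum_ge:
  assumes "covering X"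
  shows "1 / 2 \<le> weight_sum X n"
proof -
  have "\<exists>z. val ` cylinder X w \<subseteq> {z - weight w * vmax .. z + weight w * vmax}"
    if "w \<in> prefixes X n" for w
  proof -
    obtain u where u: "u \<in> cylinder X w" using \<open>w \<in> prefixes X n\<close> by (auto simp: in_prefixes_iff)
    have "val v \<in> {val u - weight w * vmax .. val u + weight w * vmax}" if v: "v \<in> cylinder X w" for v
    proof -
      have "prefix_of v (length w) = w" "prefix_of u (length w) = w"
        using u v by (auto simp only: cylinder_def mem_Collect_eq)
      then have "\<bar>val v - val u\<bar> \<le> weight w * vmax"
        using val_diff_le[of v "length w" u] by (simp only: simp_thms)
      then show ?thesis by auto
    qed
    then show ?thesis by blast
  qed
  then obtain pt where pt: "val ` cylinder X w \<subseteq> {pt w - weight w * vmax .. pt w + weight w * vmax}"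
    if "w \<in> prefixes X n" for w using that by (meson bchoice)
  let ?V = "\<lambda>w. {pt w - weight w * vmax .. pt w + weight w * vmax}"
  have "u \<in> (\<Union>w\<in>prefixes X n. cylinder X w)" if "u \<in> X" for u
  proof (rule UN_I)
    show "prefix_of u n \<in> prefixes X n" using that unfolding prefixes_def by (rule imageI)
    show "u \<in> cylinder X (prefix_of u n)" using that by (simp add: cylinder_def)
  qed
  then have "val ` X \<subseteq> (\<Union>w\<in>prefixes X n. ?V w)"
    using pt by blast
  then have "{0..vmax} \<subseteq> (\<Union>w\<in>prefixes X n. ?V w)"
    using assms by (auto simp only: covering_def)
  then have "measure lborel {0..vmax} \<le> measure lborel (\<Union>w\<in>prefixes X n. ?V w)"
    by (intro measure_mono_fmeasurable fmeasurable.finite_UN) (auto simp: fmeasurable_def emeasure_lborel_Icc_eq)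
  also have "\<dots> \<le> (\<Sum>w\<in>prefixes X n. measure lborel (?V w))"
    by (intro measure_UNION_le) auto
  also have "\<dots> = (\<Sum>w\<in>prefixes X n. 2 * vmax * weight w)"
    using vmax_pos weight_pos by (intro sum.cong) (auto simp: less_imp_le)
  also have "\<dots> = 2 * vmax * weight_sum X n"
    by (simp add: weight_sum_def sum_distrib_left)
  finally show ?thesis using vmax_pos by (simp add: field_simps)
qed

end

section \<open>Expansions by a threshold\<close>

text \<open>A sequence starting with \<open>0\<close> is automatically below \<open>b\<close>, and one starting with \<open>1\<close> is above \<open>a\<close>;
so each tail meets only one of the two bounds.\<close>
lemma Omega_iff:
  assumes "\<not> a 0" "b 0"
  shows "u \<in> Omega a b \<longleftrightarrow>
    (\<forall>n. (\<not> u n \<longrightarrow> \<not> less_fun a (shift n u)) \<and> (u n \<longrightarrow> \<not> less_fun (shift n u) b))"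
proof -
  have "\<not> u n \<Longrightarrow> less_fun (shift n u) b" "u n \<Longrightarrow> less_fun a (shift n u)" for n
    using assms by (auto simp: less_fun_bool intro!: exI[of _ 0])
  then show ?thesis by (auto simp: Omega_def lex_interval_def)
qed

lemma shift_closed_Omega: "shift_closed (Omega a b)"
  by (simp add: shift_closed_def Omega_def)

context two_bases
begin

text \<open>The inverse branches of this expanding map are \<open>z / p0\<close> and \<open>(1 + z) / p1\<close>, by which a leading digit
acts on values; its itineraries are therefore expansions.\<close>
definition step :: "(real \<Rightarrow> bool) \<Rightarrow> real \<Rightarrow> real" where
  "step D z = (if D z then p1 * z - 1 else p0 * z)"

definition itinerary :: "(real \<Rightarrow> bool) \<Rightarrow> real \<Rightarrow> binseq" where
  "itinerary D z = (\<lambda>n. D ((step D ^^ n) z))"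

text \<open>These inequalities are what keeps \<open>step D\<close> inside \<open>{0..vmax}\<close>: a digit is chosen only if the remaining
value can still be expanded.\<close>
definition digit_rule :: "(real \<Rightarrow> bool) \<Rightarrow> bool" where
  "digit_rule D \<longleftrightarrow> (\<forall>z. (D z \<longrightarrow> 1 / p1 \<le> z) \<and> (\<not> D z \<longrightarrow> z \<le> vmax / p0))"

lemma step_in:
  assumes "digit_rule D" "z \<in> {0..vmax}"
  shows "step D z \<in> {0..vmax}"
proof (cases "D z")
  case True
  then have "1 / p1 \<le> z" using assms by (simp add: digit_rule_def)
  then have "0 \<le> p1 * z - 1" using p1 by (simp add: field_simps)
  moreover have "p1 * z \<le> p1 * vmax" using assms p1 by simp
  moreover have "p1 * vmax = 1 + vmax" using vmax_fixed p1 by (simp add: field_simps)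
  ultimately show ?thesis using True by (simp add: step_def)
next
  case False
  then have "z \<le> vmax / p0" using assms by (simp add: digit_rule_def)
  then show ?thesis using assms p0 False by (simp add: step_def field_simps)
qed

lemma orbit_in:
  "digit_rule D \<Longrightarrow> z \<in> {0..vmax} \<Longrightarrow> (step D ^^ n) z \<in> {0..vmax}"
proof (induction n)
  case (Suc n)
  then show ?case using step_in[of D "(step D ^^ n) z"] by (simp only: funpow.simps comp_apply)
qed simp

lemma shift_itinerary: "shift n (itinerary D z) = itinerary D ((step D ^^ n) z)"
proof
  fix k
  have "(step D ^^ (n + k)) z = (step D ^^ k) ((step D ^^ n) z)"
    by (subst add.commute) (simp only: funpow_add comp_apply)
  then show "shift n (itinerary D z) k = itinerary D ((step D ^^ n) z) k"
    by (simp add: itinerary_def)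
qed

lemma itinerary_0: "itinerary D z 0 = D z"
  by (simp add: itinerary_def)

lemma funpow_1: "((f :: real \<Rightarrow> real) ^^ 1) z = f z"
  by simp

lemma val_itinerary:
  assumes D: "digit_rule D" and z: "z \<in> {0..vmax}"
  shows "val (itinerary D z) = z"
proof -
  let ?f = "\<lambda>z. \<bar>val (itinerary D z) - z\<bar>"
  have "?f z \<le> 0 / (1 - ratio)"
  proof (rule contraction_bound[where X = "{0..vmax}" and f = ?f and \<rho> = ratio and B = vmax])
    fix z assume z: "z \<in> {0..vmax}"
    show "?f z \<le> vmax"
      using z val_nonneg[of "itinerary D z"] val_le_vmax[of "itinerary D z"] by (auto simp: abs_le_iff)
    have "val (itinerary D z) - z
        = (1 / (if D z then p1 else p0)) * (val (itinerary D (step D z)) - step D z)"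
      using val_unfold[of "itinerary D z"] p0 p1
      unfolding shift_itinerary itinerary_0 funpow_1 step_def
      by (simp add: diff_divide_distrib add_divide_distrib)
    then have "?f z = (1 / (if D z then p1 else p0)) * ?f (step D z)"
      using p0 p1 by (simp add: abs_mult)
    also have "\<dots> \<le> ratio * ?f (step D z)"
      using ratio by (intro mult_right_mono) auto
    finally have "?f z \<le> ratio * max 0 (?f (step D z)) + 0" by simp
    then show "\<exists>v\<in>{0..vmax}. ?f z \<le> ratio * max 0 (?f v) + 0"
      using step_in[OF D z] by blast
  qed (use ratio z in auto)
  then show ?thesis by simp
qed

text \<open>As long as two orbits produce the same digits, their distance grows by the inverse weight; in
particular they keep their order and never come closer than at the start.\<close>
lemma orbit_diff:
  assumes "digit_rule D" "digit_rule E" "y \<in> {0..vmax}" "z \<in> {0..vmax}"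
    and "\<And>k. k < n \<Longrightarrow> itinerary D y k = itinerary E z k"
  shows "y - z = weight (prefix_of (itinerary D y) n) * ((step D ^^ n) y - (step E ^^ n) z)"
proof -
  have shifts: "val (shift n (itinerary D y)) = (step D ^^ n) y" "val (shift n (itinerary E z)) = (step E ^^ n) z"
    unfolding shift_itinerary by (intro val_itinerary orbit_in assms)+
  have vals: "val (itinerary D y) = y" "val (itinerary E z) = z"
    by (intro val_itinerary assms)+
  have "val (itinerary D y) - val (itinerary E z) = weight (prefix_of (itinerary D y) n)
      * (val (shift n (itinerary D y)) - val (shift n (itinerary E z)))"
    by (intro val_diff assms)
  then show ?thesis unfolding shifts vals .
qed

text \<open>The two itineraries of a threshold \<open>c\<close> for \<open>c\<close> itself: \<open>lower\<close> takes the digit \<open>0\<close> whenever the orbit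
hits \<open>c\<close>, and \<open>upper\<close> takes \<open>1\<close>.  They play the role of the kneading sequences of the map.\<close>
definition lower :: "real \<Rightarrow> binseq" where
  "lower c = itinerary (\<lambda>z. c < z) c"

definition upper :: "real \<Rightarrow> binseq" where
  "upper c = itinerary (\<lambda>z. c \<le> z) c"

text \<open>The numbers that have an expansion starting with \<open>0\<close> as well as one starting with \<open>1\<close> in the full
shift.\<close>
definition thresholds :: "real set" where
  "thresholds = {1 / p1 .. vmax / p0}"

lemma thresholds:
  assumes "c \<in> thresholds"
  shows "digit_rule (\<lambda>z. c < z)" "digit_rule (\<lambda>z. c \<le> z)" "c \<in> {0..vmax}"
proof -
  have "vmax / p0 \<le> vmax" using vmax_pos p0 by (simp add: divide_le_eq mult_left_le)
  moreover have "0 \<le> c"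
    using assms p1 order_trans[of 0 "1 / p1" c] by (simp add: thresholds_def)
  ultimately show "digit_rule (\<lambda>z. c < z)" "digit_rule (\<lambda>z. c \<le> z)" "c \<in> {0..vmax}"
    using assms unfolding thresholds_def digit_rule_def by auto
qed

text \<open>Expansion by a threshold preserves order, so every tail of an itinerary lies on the correct side of
\<open>lower c\<close> or \<open>upper c\<close>, and a fortiori of \<open>a\<close> or \<open>b\<close>.\<close>
lemma threshold_covering:
  assumes ab: "\<not> a 0" "b 0" and c: "c \<in> thresholds"
    and low: "\<not> less_fun a (lower c)" and up: "\<not> less_fun (upper c) b"
  shows "covering (Omega a b)"
  unfolding covering_def
proof
  fix z assume z: "z \<in> {0..vmax}"
  let ?D = "\<lambda>z. c \<le> z"
  note c = thresholds[OF c]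
  have below: "\<not> less_fun a (itinerary ?D y)" if y: "y \<in> {0..vmax}" "y < c" for y
  proof
    assume "less_fun a (itinerary ?D y)"
    with low have "less_fun (lower c) (itinerary ?D y)"
      by (rule less_fun_le_trans)
    then obtain n where n: "\<not> lower c n" "itinerary ?D y n" "\<And>k. k < n \<Longrightarrow> lower c k = itinerary ?D y k"
      unfolding less_fun_bool by blast
    define w where "w = weight (prefix_of (lower c) n)"
    have "c - y = w * ((step (\<lambda>z. c < z) ^^ n) c - (step ?D ^^ n) y)"
      unfolding w_def lower_def
      by (rule orbit_diff[OF c(1,2,3) y(1)]) (rule n(3)[unfolded lower_def])
    moreover have "(step (\<lambda>z. c < z) ^^ n) c \<le> (step ?D ^^ n) y"
      using n(1,2) by (simp add: lower_def itinerary_def)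
    ultimately show False
      using y weight_pos[of "prefix_of (lower c) n", folded w_def]
        mult_nonneg_nonpos[of w "(step (\<lambda>z. c < z) ^^ n) c - (step ?D ^^ n) y"] by simp
  qed
  have above: "\<not> less_fun (itinerary ?D y) b" if y: "y \<in> {0..vmax}" "c \<le> y" for y
  proof
    assume "less_fun (itinerary ?D y) b"
    with up have "less_fun (itinerary ?D y) (upper c)"
      by (rule less_fun_le_trans)
    then obtain n where n: "\<not> itinerary ?D y n" "upper c n" "\<And>k. k < n \<Longrightarrow> itinerary ?D y k = upper c k"
      unfolding less_fun_bool by blast
    define w where "w = weight (prefix_of (itinerary ?D y) n)"
    have "y - c = w * ((step ?D ^^ n) y - (step ?D ^^ n) c)"
      unfolding w_def
      by (rule orbit_diff[OF c(2,2) y(1) c(3)]) (rule n(3)[unfolded upper_def])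
    moreover have "(step ?D ^^ n) y < (step ?D ^^ n) c"
      using n(1,2) by (simp add: upper_def itinerary_def)
    ultimately show False
      using y weight_pos[of "prefix_of (itinerary ?D y) n", folded w_def]
        mult_pos_neg[of w "(step ?D ^^ n) y - (step ?D ^^ n) c"] by simp
  qed
  have "itinerary ?D z \<in> Omega a b"
    unfolding Omega_iff[where a = a and b = b, OF ab] shift_itinerary
    using below above orbit_in[OF c(2) z] by (auto simp: itinerary_def)
  then show "z \<in> val ` Omega a b"
    using val_itinerary[OF c(2) z] by (metis image_eqI)
qed

text \<open>Suppose \<open>u\<close> starts with \<open>0\<close> but has a value above \<open>c\<close>.  At its first difference with \<open>lower c\<close>, the
orbit of \<open>c\<close> is above \<open>c\<close> because it produces the digit \<open>1\<close>, while the tail of \<open>u\<close> starts with \<open>0\<close>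
again and must exceed \<open>c\<close> by even more.  So the violation of the claim is contracted along tails.\<close>
lemma threshold_sides:
  assumes ab: "\<not> a 0" "b 0" and c: "c \<in> thresholds"
    and low: "\<not> less_fun (lower c) a" and up: "\<not> less_fun b (upper c)"
    and u: "u \<in> Omega a b"
  shows "if u 0 then c \<le> val u else val u \<le> c"
proof -
  let ?f = "\<lambda>u. if u 0 then c - val u else val u - c"
  note c = thresholds[OF c]
  have "?f u \<le> 0 / (1 - ratio)"
  proof (rule contraction_bound[where X = "Omega a b" and f = ?f and \<rho> = ratio and B = vmax])
    fix u assume u: "u \<in> Omega a b"
    show "?f u \<le> vmax"
      using c(3) val_nonneg[of u] val_le_vmax[of u] by auto
    have shift_in: "shift n u \<in> Omega a b" for n
      using u shift_closed_Omega by (auto simp: shift_closed_def)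
    have vals: "val (lower c) = c" "val (upper c) = c"
      using c by (simp_all add: lower_def upper_def val_itinerary)
    have contr: "\<exists>v\<in>Omega a b. ?f u \<le> ratio * max 0 (?f v) + 0"
      if "?f u \<le> weight (prefix_of u n) * ?f (shift n u)" "0 < n" for n
    proof -
      have "weight (prefix_of u n) * ?f (shift n u) \<le> weight (prefix_of u n) * max 0 (?f (shift n u))"
        using weight_pos[of "prefix_of u n"] by (intro mult_left_mono) auto
      also have "\<dots> \<le> ratio * max 0 (?f (shift n u))"
        using weight_le_ratio[of "prefix_of u n"] \<open>0 < n\<close> by (intro mult_right_mono) auto
      finally show ?thesis using that(1) shift_in[of n] by (intro bexI[of _ "shift n u"]) linarith+
    qed
    consider "?f u = 0" | "\<not> u 0" "less_fun u (lower c)" | "u 0" "less_fun (upper c) u"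
    proof (cases "u 0")
      case False
      then have "\<not> less_fun a u" using u ab by (auto simp: Omega_iff dest: spec[of _ 0])
      then have "\<not> less_fun (lower c) u" using low less_fun_le_trans(1) by blast
      then show thesis using less_fun_linear[of u "lower c"] False vals that by auto
    next
      case True
      then have "\<not> less_fun u b" using u ab by (auto simp: Omega_iff dest: spec[of _ 0])
      then have "\<not> less_fun u (upper c)" using up less_fun_le_trans(2) by blast
      then show thesis using less_fun_linear[of u "upper c"] True vals that by auto
    qed
    then show "\<exists>v\<in>Omega a b. ?f u \<le> ratio * max 0 (?f v) + 0"
    proof cases
      case 1
      then show ?thesis using u ratio by (intro bexI[of _ u]) auto
    next
      case 2
      then obtain n where n: "\<not> u n" "lower c n" "\<And>k. k < n \<Longrightarrow> u k = lower c k"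
        unfolding less_fun_bool by blast
      let ?z = "(step (\<lambda>z. c < z) ^^ n) c"
      have "val (shift n (lower c)) = ?z"
        unfolding lower_def shift_itinerary by (intro val_itinerary orbit_in c)
      moreover have "c < ?z" using n(2) by (simp add: lower_def itinerary_def)
      ultimately have "val (shift n u) - val (shift n (lower c)) \<le> ?f (shift n u)"
        using n(1) by simp
      then have "val u - c \<le> weight (prefix_of u n) * ?f (shift n u)"
        using val_diff[of n u "lower c"] n(3) weight_pos[of "prefix_of u n"] vals
        by (simp only: mult_le_cancel_left_pos)
      moreover have "0 < n" using n(2) by (cases n) (auto simp: lower_def itinerary_def)
      ultimately show ?thesis using contr[of n] 2 by (simp only: if_False)
    next
      case 3
      then obtain n where n: "\<not> upper c n" "u n" "\<And>k. k < n \<Longrightarrow> upper c k = u k"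
        unfolding less_fun_bool by blast
      let ?z = "(step (\<lambda>z. c \<le> z) ^^ n) c"
      have "val (shift n (upper c)) = ?z"
        unfolding upper_def shift_itinerary by (intro val_itinerary orbit_in c)
      moreover have "?z < c" using n(1) by (simp add: upper_def itinerary_def)
      ultimately have "val (shift n (upper c)) - val (shift n u) \<le> ?f (shift n u)"
        using n(2) by simp
      moreover have "prefix_of (upper c) n = prefix_of u n"
        using n(3) by (simp only: prefix_of_eq_iff) blast
      ultimately have "c - val u \<le> weight (prefix_of u n) * ?f (shift n u)"
        using val_diff[of n "upper c" u] n(3) weight_pos[of "prefix_of u n"] vals
        by (simp only: mult_le_cancel_left_pos)
      moreover have "0 < n" using n(1) by (cases n) (auto simp: upper_def itinerary_def)
      ultimately show ?thesis using contr[of n] 3 by (simp only: if_True)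
    qed
  qed (use ratio u in auto)
  then show ?thesis by (simp split: if_splits)
qed

text \<open>A weak separation already makes the expansion monotone on \<open>Omega a b\<close>.  As \<open>a\<close> and \<open>b\<close> are the sequences
next to the hole, the gap is then the one between their values.\<close>
lemma separatedI:
  assumes ab: "(a, b) \<in> admissible_pairs"
    and sides: "\<And>u v. u \<in> Omega a b \<Longrightarrow> v \<in> Omega a b \<Longrightarrow> \<not> u 0 \<Longrightarrow> v 0 \<Longrightarrow> val u \<le> val v"
    and less: "val a < val b"
  shows "separated (Omega a b)"
proof -
  have digits: "\<not> a 0" "b 0" and mem: "a \<in> Omega a b" "b \<in> Omega a b"
    using ab by (auto simp: admissible_pairs_def)
  have mono: "val u \<le> val v" if "u \<in> Omega a b" "v \<in> Omega a b" "less_fun u v" for u v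
  proof -
    obtain n where n: "\<not> u n" "v n" "\<And>k. k < n \<Longrightarrow> u k = v k"
      using \<open>less_fun u v\<close> unfolding less_fun_bool by blast
    have "shift n w \<in> Omega a b" if "w \<in> Omega a b" for w
      using that shift_closed_Omega by (auto simp: shift_closed_def)
    then have "val (shift n u) \<le> val (shift n v)"
      using sides[of "shift n u" "shift n v"] that n by auto
    then have "weight (prefix_of u n) * (val (shift n u) - val (shift n v)) \<le> 0"
      using weight_pos[of "prefix_of u n"] by (intro mult_nonneg_nonpos) auto
    then show ?thesis using val_diff[of n u v] n(3) by simp
  qed
  have "val u + (val b - val a) \<le> val v"
    if u: "u \<in> Omega a b" "\<not> u 0" and v: "v \<in> Omega a b" "v 0" for u v
  proof -
    have "\<not> less_fun a u" "\<not> less_fun v b"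
      using u v digits by (auto simp: Omega_iff dest: spec[of _ 0])
    then have "u = a \<or> less_fun u a" "v = b \<or> less_fun b v" using less_fun_linear by blast+
    then have "val u \<le> val a" "val b \<le> val v" using mono u v mem by auto
    then show ?thesis by linarith
  qed
  then show ?thesis using less unfolding separated_def by (intro exI[of _ "val b - val a"]) auto
qed

lemma threshold_separated:
  assumes ab: "(a, b) \<in> admissible_pairs" and c: "c \<in> thresholds"
    and low: "\<not> less_fun (lower c) a" and up: "\<not> less_fun b (upper c)"
    and strict: "a \<noteq> lower c \<or> b \<noteq> upper c"
  shows "separated (Omega a b)"
proof -
  have digits: "\<not> a 0" "b 0" and mem: "a \<in> Omega a b" "b \<in> Omega a b"
    using ab by (auto simp: admissible_pairs_def)
  have shift_in: "shift n u \<in> Omega a b" if "u \<in> Omega a b" for u n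
    using that shift_closed_Omega by (auto simp: shift_closed_def)
  note sides = threshold_sides[OF digits c low up]
  have left: "val u \<le> c" if "u \<in> Omega a b" "\<not> u 0" for u using sides[OF that(1)] that(2) by simp
  have right: "c \<le> val u" if "u \<in> Omega a b" "u 0" for u using sides[OF that(1)] that(2) by simp
  have c': "digit_rule (\<lambda>z. c < z)" "digit_rule (\<lambda>z. c \<le> z)" "c \<in> {0..vmax}"
    using thresholds[OF c] by blast+
  have vals: "val (lower c) = c" "val (upper c) = c"
    using c' by (simp_all add: lower_def upper_def val_itinerary)
  have "val a < c" if "a \<noteq> lower c"
  proof -
    have "less_fun a (lower c)" using less_fun_linear low that by blast
    then obtain n where n: "\<not> a n" "lower c n" "\<And>k. k < n \<Longrightarrow> a k = lower c k"
      unfolding less_fun_bool by blast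
    have "val (shift n (lower c)) = (step (\<lambda>z. c < z) ^^ n) c"
      unfolding lower_def shift_itinerary by (intro val_itinerary orbit_in c')
    moreover have "c < (step (\<lambda>z. c < z) ^^ n) c" using n(2) by (simp add: lower_def itinerary_def)
    moreover have "val (shift n a) \<le> c" using left[of "shift n a"] shift_in mem n by simp
    ultimately have "weight (prefix_of a n) * (val (shift n a) - val (shift n (lower c))) < 0"
      using weight_pos[of "prefix_of a n"] by (intro mult_pos_neg) auto
    then show ?thesis using val_diff[of n a "lower c"] n(3) vals by simp
  qed
  moreover have "c < val b" if "b \<noteq> upper c"
  proof -
    have "less_fun (upper c) b" using less_fun_linear up that by blast
    then obtain n where n: "\<not> upper c n" "b n" "\<And>k. k < n \<Longrightarrow> upper c k = b k"
      unfolding less_fun_bool by blast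
    have "val (shift n (upper c)) = (step (\<lambda>z. c \<le> z) ^^ n) c"
      unfolding upper_def shift_itinerary by (intro val_itinerary orbit_in c')
    moreover have "(step (\<lambda>z. c \<le> z) ^^ n) c < c" using n(1) by (simp add: upper_def itinerary_def)
    moreover have "c \<le> val (shift n b)" using right[of "shift n b"] shift_in mem n by simp
    ultimately have "weight (prefix_of (upper c) n) * (val (shift n (upper c)) - val (shift n b)) < 0"
      using weight_pos[of "prefix_of (upper c) n"] by (intro mult_pos_neg) auto
    then show ?thesis using val_diff[of n "upper c" b] n(3) vals by simp
  qed
  ultimately have "val a < val b"
    using strict left[OF mem(1) digits(1)] right[OF mem(2) digits(2)] by linarith
  moreover have "val u \<le> val v"
    if "u \<in> Omega a b" "v \<in> Omega a b" "\<not> u 0" "v 0" for u v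
    using left[of u] right[of v] that by linarith
  ultimately show ?thesis using separatedI[OF ab] by blast
qed

text \<open>The orbits of \<open>e\<close> and \<open>c\<close> under their own thresholds differ by at least \<open>e - c\<close> as long as the digits
agree.  Hence, when the orbit of \<open>c\<close> is at or above \<open>c\<close>, that of \<open>e > c\<close> is at or above \<open>e\<close>; and a
positive distance below \<open>c\<close> is not bridged if \<open>e\<close> is close to \<open>c\<close>.\<close>
lemma upper_right_continuous:
  assumes c: "c \<in> thresholds"
  shows "\<forall>\<^sub>F e in at_right c. e \<in> thresholds \<longrightarrow> (\<forall>k<n. upper e k = upper c k)"
proof (induction n)
  case (Suc n)
  let ?z = "\<lambda>e. (step (\<lambda>z. e \<le> z) ^^ n) e"
  define w where "w = weight (prefix_of (upper c) n)"
  have w: "0 < w" "w \<le> 1" unfolding w_def by (rule weight_pos, rule weight_le_one)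
  have "c < (if c \<le> ?z c then c + 1 else c + w * (c - ?z c))" using w by auto
  then have "\<forall>\<^sub>F e in at_right c. e < (if c \<le> ?z c then c + 1 else c + w * (c - ?z c))"
    by (rule order_tendstoD[OF tendsto_ident_at])
  moreover have "\<forall>\<^sub>F e in at_right c. c < e" by (rule eventually_at_right_less)
  ultimately show ?case using Suc
  proof eventually_elim
    case (elim e)
    show ?case
    proof
      assume e: "e \<in> thresholds"
      then have agree: "\<And>k. k < n \<Longrightarrow> upper c k = upper e k" using elim(3) by simp
      have diff: "c - e = w * (?z c - ?z e)"
        unfolding w_def upper_def
        by (rule orbit_diff[OF thresholds(2)[OF c] thresholds(2)[OF e] thresholds(3)[OF c] thresholds(3)[OF e]])
           (rule agree[unfolded upper_def])
      have "c \<le> ?z c \<longleftrightarrow> e \<le> ?z e"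
      proof (cases "c \<le> ?z c")
        case True
        have "w * (?z e - ?z c) = e - c" using diff by (simp add: algebra_simps)
        moreover from this have "0 < ?z e - ?z c"
          using elim(2) w zero_less_mult_pos[of w "?z e - ?z c"] by simp
        ultimately have "e - c \<le> ?z e - ?z c"
          using w mult_right_le_one_le[of "?z e - ?z c" w] by (simp add: mult.commute)
        then show ?thesis using True by simp
      next
        case False
        then have "e - c < w * (c - ?z c)" using elim(1) by simp
        then have "w * (?z e - ?z c) < w * (c - ?z c)" using diff by (simp add: algebra_simps)
        then have "?z e < c" using w by simp
        then show ?thesis using False elim(2) by simp
      qed
      then have "upper c n = upper e n" by (simp add: upper_def itinerary_def)
      then show "\<forall>k<Suc n. upper e k = upper c k" using agree by (auto simp: less_Suc_eq)
    qed
  qed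
qed simp

lemma lower_left_continuous:
  assumes c: "c \<in> thresholds"
  shows "\<forall>\<^sub>F e in at_left c. e \<in> thresholds \<longrightarrow> (\<forall>k<n. lower e k = lower c k)"
proof (induction n)
  case (Suc n)
  let ?z = "\<lambda>e. (step (\<lambda>z. e < z) ^^ n) e"
  define w where "w = weight (prefix_of (lower c) n)"
  have w: "0 < w" "w \<le> 1" unfolding w_def by (rule weight_pos, rule weight_le_one)
  have "(if ?z c \<le> c then c - 1 else c - w * (?z c - c)) < c" using w by auto
  then have "\<forall>\<^sub>F e in at_left c. (if ?z c \<le> c then c - 1 else c - w * (?z c - c)) < e"
    by (rule order_tendstoD[OF tendsto_ident_at])
  moreover have "\<forall>\<^sub>F e in at_left c. e < c" by (simp add: eventually_at_filter)
  ultimately show ?case using Suc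
  proof eventually_elim
    case (elim e)
    show ?case
    proof
      assume e: "e \<in> thresholds"
      then have agree: "\<And>k. k < n \<Longrightarrow> lower c k = lower e k" using elim(3) by simp
      have diff: "c - e = w * (?z c - ?z e)"
        unfolding w_def lower_def
        by (rule orbit_diff[OF thresholds(1)[OF c] thresholds(1)[OF e] thresholds(3)[OF c] thresholds(3)[OF e]])
           (rule agree[unfolded lower_def])
      have "?z c \<le> c \<longleftrightarrow> ?z e \<le> e"
      proof (cases "?z c \<le> c")
        case True
        have "0 < ?z c - ?z e"
          using diff elim(2) w zero_less_mult_pos[of w "?z c - ?z e"] by simp
        then have "c - e \<le> ?z c - ?z e"
          using diff w mult_right_le_one_le[of "?z c - ?z e" w] by (simp add: mult.commute)
        then show ?thesis using True by simp
      next
        case False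
        then have "c - e < w * (?z c - c)" using elim(1) by simp
        then have "w * (?z c - ?z e) < w * (?z c - c)" using diff by simp
        then have "c < ?z e" using w by simp
        then show ?thesis using False elim(2) by simp
      qed
      then have "lower c n = lower e n" by (auto simp: lower_def itinerary_def)
      then show "\<forall>k<Suc n. lower e k = lower c k" using agree by (auto simp: less_Suc_eq)
    qed
  qed
qed simp

lemma upper_smallest:
  assumes "0 < n"
  shows "\<not> upper (1 / p1) n"
proof -
  have "(step (\<lambda>z. 1 / p1 \<le> z) ^^ Suc m) (1 / p1) = 0" for m
    using p1 by (induction m) (simp_all add: step_def)
  then have "(step (\<lambda>z. 1 / p1 \<le> z) ^^ n) (1 / p1) = 0" using assms by (metis gr0_implies_Suc)
  then show ?thesis using p1 by (simp add: upper_def itinerary_def)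
qed

lemma lower_largest:
  assumes "0 < n"
  shows "lower (vmax / p0) n"
proof -
  have lt: "vmax / p0 < vmax" using vmax_pos p0 by (simp add: divide_less_eq)
  have vfix: "p1 * vmax - 1 = vmax" using vmax_fixed p1 by (simp add: field_simps)
  have "(step (\<lambda>z. vmax / p0 < z) ^^ Suc m) (vmax / p0) = vmax" for m
    using p0 lt vfix by (induction m) (simp_all add: step_def)
  then have "(step (\<lambda>z. vmax / p0 < z) ^^ n) (vmax / p0) = vmax" using assms by (metis gr0_implies_Suc)
  then show ?thesis using lt by (simp add: lower_def itinerary_def)
qed

text \<open>The threshold is taken at the supremum \<open>c\<close> of those with \<open>lower c\<close> not above \<open>a\<close>.  Left continuity shows
that \<open>c\<close> itself has this property.  If \<open>upper c\<close> is not below \<open>b\<close>, then \<open>c\<close> shows that the set is covering.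
Otherwise right continuity keeps \<open>upper e\<close> below \<open>b\<close> for some \<open>e > c\<close>, while \<open>lower e\<close> is above \<open>a\<close>, and
\<open>e\<close> separates.  At the two ends of the interval of thresholds, the extreme sequences \<open>1000...\<close> and
\<open>0111...\<close> make one of the two comparisons automatic.\<close>
theorem separated_or_covering:
  assumes ab: "(a, b) \<in> admissible_pairs"
  shows "separated (Omega a b) \<or> covering (Omega a b)"
proof (cases "1 / p1 \<le> vmax / p0")
  case False
  \<comment> \<open>There is no threshold: \<open>0111...\<close> has a smaller value than \<open>1000...\<close>.\<close>
  have "val u + (1 / p1 - vmax / p0) \<le> val v" if "\<not> u 0" "v 0" for u v
  proof -
    have "val u \<le> vmax / p0"
      using that val_unfold[of u] val_le_vmax[of "shift 1 u"] p0 by (simp add: divide_right_mono)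
    moreover have "1 / p1 \<le> val v"
      using that val_unfold[of v] val_nonneg[of "shift 1 v"] p1 by (simp add: divide_right_mono)
    ultimately show ?thesis by linarith
  qed
  then have "separated (Omega a b)"
    using False unfolding separated_def by (intro exI[of _ "1 / p1 - vmax / p0"]) auto
  then show ?thesis ..
next
  case True
  have digits: "\<not> a 0" "b 0" using ab by (auto simp: admissible_pairs_def)
  have ends: "1 / p1 \<in> thresholds" "vmax / p0 \<in> thresholds" using True by (auto simp: thresholds_def)
  define C where "C = {c \<in> thresholds. \<not> less_fun a (lower c)}"
  show ?thesis
  proof (cases "C = {}")
    case True
    then have "less_fun a (lower (1 / p1))" using ends by (auto simp: C_def)
    moreover have "\<not> less_fun b (upper (1 / p1))"
      unfolding less_fun_bool using upper_smallest digits by (metis gr0I)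
    ultimately have "separated (Omega a b)"
      using threshold_separated[OF ab ends(1)] less_fun_asym less_fun_irrefl by metis
    then show ?thesis ..
  next
    case False
    define c where "c = Sup C"
    have bdd: "bdd_above C" by (rule bdd_aboveI[of _ "vmax / p0"]) (auto simp: C_def thresholds_def)
    have c: "c \<in> thresholds"
    proof -
      obtain d where d: "d \<in> C" using False by blast
      then have "d \<le> c" unfolding c_def using bdd by (rule cSup_upper)
      moreover have "c \<le> vmax / p0"
        unfolding c_def using False by (intro cSup_least) (auto simp: C_def thresholds_def)
      ultimately show ?thesis using d by (auto simp: C_def thresholds_def)
    qed
    have "c \<in> C"
    proof (rule ccontr)
      assume "c \<notin> C"
      then obtain n where n: "\<not> a n" "lower c n" "\<forall>k<n. a k = lower c k"
        using c unfolding C_def less_fun_bool by auto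
      from lower_left_continuous[OF c, of "Suc n"]
      obtain d where d: "d < c" "\<And>e. d < e \<Longrightarrow> e < c \<Longrightarrow> e \<in> thresholds \<Longrightarrow> \<forall>k<Suc n. lower e k = lower c k"
        unfolding eventually_at_left_field by metis
      then obtain e where e: "e \<in> C" "d < e" unfolding c_def using less_cSupD[OF False] by blast
      moreover have "e \<noteq> c" "e \<le> c" using \<open>c \<notin> C\<close> e bdd by (auto simp: c_def intro: cSup_upper)
      ultimately have "\<forall>k<Suc n. lower e k = lower c k" using d(2)[of e] by (auto simp: C_def)
      then have "less_fun a (lower e)" using n unfolding less_fun_bool by (intro exI[of _ n]) auto
      then show False using e by (simp add: C_def)
    qed
    then have low: "\<not> less_fun a (lower c)" by (simp add: C_def)
    show ?thesis
    proof (cases "less_fun (upper c) b")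
      case False
      then show ?thesis using threshold_covering[where a = a and b = b, OF digits c low] by blast
    next
      case True
      have "\<exists>e\<in>thresholds. \<not> less_fun (lower e) a \<and> less_fun (upper e) b"
      proof (cases "c = vmax / p0")
        case True
        then have "\<not> less_fun (lower c) a"
          unfolding less_fun_bool using lower_largest digits by (metis gr0I)
        then show ?thesis using c \<open>less_fun (upper c) b\<close> by blast
      next
        case False
        obtain n where n: "\<not> upper c n" "b n" "\<forall>k<n. upper c k = b k"
          using True unfolding less_fun_bool by blast
        from upper_right_continuous[OF c, of "Suc n"]
        obtain d where d: "c < d" "\<And>e. c < e \<Longrightarrow> e < d \<Longrightarrow> e \<in> thresholds \<Longrightarrow> \<forall>k<Suc n. upper e k = upper c k"
          unfolding eventually_at_right_field by metis
        have "c < min d (vmax / p0)" using d(1) False c by (auto simp: thresholds_def)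
        then obtain e where e: "c < e" "e < min d (vmax / p0)" using dense by blast
        then have et: "e \<in> thresholds" using c by (auto simp: thresholds_def)
        then have "\<forall>k<Suc n. upper e k = upper c k" using d(2) e by simp
        then have "less_fun (upper e) b" using n unfolding less_fun_bool by (intro exI[of _ n]) auto
        moreover have "e \<notin> C" using e bdd cSup_upper[of e C] by (auto simp: c_def)
        then have "less_fun a (lower e)" using et by (simp add: C_def)
        then have "\<not> less_fun (lower e) a" by (rule less_fun_asym)
        ultimately show ?thesis using et by blast
      qed
      then obtain e where e: "e \<in> thresholds" "\<not> less_fun (lower e) a" "less_fun (upper e) b" by blast
      then have "\<not> less_fun b (upper e)" "b \<noteq> upper e"
        using less_fun_asym less_fun_irrefl by blast+
      then show ?thesis using threshold_separated[OF ab e(1,2)] by blast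
    qed
  qed
qed

section \<open>The critical exponent\<close>

abbreviation val_at :: "real \<Rightarrow> binseq \<Rightarrow> real" where
  "val_at r \<equiv> double_base_expansion (p0 powr r) (p1 powr r)"

abbreviation separated_at :: "real \<Rightarrow> binseq set \<Rightarrow> bool" where
  "separated_at r \<equiv> two_bases.separated (p0 powr r) (p1 powr r)"

abbreviation covering_at :: "real \<Rightarrow> binseq set \<Rightarrow> bool" where
  "covering_at r \<equiv> two_bases.covering (p0 powr r) (p1 powr r)"

abbreviation weight_sum_at :: "real \<Rightarrow> binseq set \<Rightarrow> nat \<Rightarrow> real" where
  "weight_sum_at r \<equiv> two_bases.weight_sum (p0 powr r) (p1 powr r)"

lemma two_bases_powr: "0 < r \<Longrightarrow> two_bases (p0 powr r) (p1 powr r)"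
  using p0 p1 by unfold_locales (auto intro: gr_one_powr)

lemma weight_powr: "word_weight (p0 powr r) (p1 powr r) w = weight w powr r"
proof (induction w)
  case (Cons d w)
  have "word_weight (p0 powr r) (p1 powr r) (d # w)
      = word_weight (p0 powr r) (p1 powr r) w / (if d then p1 powr r else p0 powr r)"
    by (simp add: word_weight_def)
  then show ?case using Cons weight_pos[of w] p0 p1 by (simp add: powr_divide)
qed (simp add: word_weight_def)

lemma weight_sum_at_eq: "0 < r \<Longrightarrow> weight_sum_at r X n = (\<Sum>w\<in>prefixes X n. weight w powr r)"
  by (simp add: two_bases.weight_sum_def[OF two_bases_powr] weight_powr)

lemma weight_sum_at_decay:
  assumes "0 < r" "r < t"
  shows "weight_sum_at t X n \<le> (ratio powr (t - r)) ^ n * weight_sum_at r X n"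
proof -
  have "weight w powr t \<le> (ratio powr (t - r)) ^ n * weight w powr r" if "w \<in> prefixes X n" for w
  proof -
    have "weight w powr t = weight w powr (t - r) * weight w powr r"
      using powr_add[of "weight w" "t - r" r] by simp
    also have "weight w powr (t - r) \<le> (ratio ^ n) powr (t - r)"
      using assms that weight_le_power[of w] weight_pos[of w]
      by (intro powr_mono2) (auto simp: in_prefixes_iff)
    also have "(ratio ^ n) powr (t - r) = (ratio powr (t - r)) ^ n"
      using ratio by (simp add: powr_realpow[symmetric] powr_powr mult.commute)
    finally show ?thesis by (simp add: mult_right_mono)
  qed
  then show ?thesis
    using assms by (simp add: weight_sum_at_eq sum_distrib_left sum_mono)
qed

lemma separated_at_decay:
  assumes r: "0 < r" "r < t" and X: "shift_closed X" "separated_at r X"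
  shows "weight_sum_at t X \<longlonglongrightarrow> 0"
proof -
  interpret R: two_bases "p0 powr r" "p1 powr r" by (rule two_bases_powr[OF r(1)])
  obtain C where C: "0 < C" "\<And>n. weight_sum_at r X n \<le> C"
    using R.separated_weight_sum_bounded[OF X] by blast
  have "ratio powr (t - r) < 1"
    using powr_less_mono2[of "t - r" ratio 1] ratio r by simp
  then have "(\<lambda>n. (ratio powr (t - r)) ^ n * C) \<longlonglongrightarrow> 0 * C"
    by (intro tendsto_intros) auto
  then have lim: "(\<lambda>n. (ratio powr (t - r)) ^ n * C) \<longlonglongrightarrow> 0" by simp
  have "weight_sum_at t X n \<le> (ratio powr (t - r)) ^ n * C" for n
    using weight_sum_at_decay[OF r, of X n] C(2)[of n]
      mult_left_mono[OF C(2)[of n], of "(ratio powr (t - r)) ^ n"] by simp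
  moreover have "0 \<le> weight_sum_at t X n" for n
    using r by (simp add: weight_sum_at_eq sum_nonneg)
  ultimately show ?thesis
    by (intro tendsto_sandwich[OF _ _ tendsto_const lim]) auto
qed

text \<open>The weight sums at \<open>t\<close> tend to \<open>0\<close>, but those of a covering set are bounded below.\<close>
lemma separated_at_not_covering_at:
  assumes "0 < r" "r < t" "shift_closed X" "separated_at r X"
  shows "\<not> covering_at t X"
proof
  assume "covering_at t X"
  then have "1 / 2 \<le> weight_sum_at t X n" for n
    using two_bases.covering_weight_sum_ge[OF two_bases_powr] assms by simp
  then have "1 / 2 \<le> (0 :: real)"
    using separated_at_decay[OF assms] by (intro LIMSEQ_le_const) auto
  then show False by simp
qed

text \<open>Changing the bases perturbs each step of the recursion for the value by a small amount, and the
recursion contracts, so the errors add up to a bound that is the same for all sequences.\<close>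
lemma val_at_uniformly_continuous:
  assumes r: "0 < r" and e: "0 < e"
  shows "\<forall>\<^sub>F t in at r. \<forall>u. \<bar>val_at t u - val_at r u\<bar> \<le> e"
proof -
  interpret R: two_bases "p0 powr r" "p1 powr r" by (rule two_bases_powr[OF r])
  let ?k = "\<lambda>t. (\<bar>1 / p0 powr t - 1 / p0 powr r\<bar> + \<bar>1 / p1 powr t - 1 / p1 powr r\<bar>)
      * (1 + 1 / (p1 powr t - 1))"
  have "(?k \<longlongrightarrow> (\<bar>1 / p0 powr r - 1 / p0 powr r\<bar> + \<bar>1 / p1 powr r - 1 / p1 powr r\<bar>)
      * (1 + 1 / (p1 powr r - 1))) (at r)"
    using R.p0 R.p1 p0 p1 by (intro tendsto_intros) auto
  then have "((\<lambda>t. ?k t / (1 - R.ratio)) \<longlongrightarrow> 0 / (1 - R.ratio)) (at r)"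
    using R.ratio by (intro tendsto_intros) auto
  then have "\<forall>\<^sub>F t in at r. ?k t / (1 - R.ratio) < e"
    using e by (intro order_tendstoD(2)) auto
  moreover have "\<forall>\<^sub>F t in at r. 0 < t"
    using r by (rule order_tendstoD[OF tendsto_ident_at])
  ultimately show ?thesis
  proof eventually_elim
    case (elim t)
    interpret T: two_bases "p0 powr t" "p1 powr t" by (rule two_bases_powr[OF elim(2)])
    let ?d = "\<lambda>u. val_at t u - val_at r u"
    have k: "0 \<le> ?k t" using T.p1 by (intro mult_nonneg_nonneg add_nonneg_nonneg) auto
    have "\<bar>?d u\<bar> \<le> ?k t / (1 - R.ratio)" for u
    proof (rule contraction_bound[where X = UNIV and f = "\<lambda>u. \<bar>?d u\<bar>" and \<rho> = R.ratio])
      fix u :: binseq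
      show "\<bar>?d u\<bar> \<le> T.vmax + R.vmax"
        using T.val_nonneg[of u] T.val_le_vmax[of u] R.val_nonneg[of u] R.val_le_vmax[of u] by linarith
      let ?q = "\<lambda>r. if u 0 then p1 powr r else p0 powr r"
      let ?v = "shift 1 u"
      have "?d u = (1 / ?q r) * ?d ?v + (of_bool (u 0) + val_at t ?v) * (1 / ?q t - 1 / ?q r)"
        using T.val_unfold[of u] R.val_unfold[of u] T.p0 T.p1 R.p0 R.p1
        by (simp add: algebra_simps add_divide_distrib diff_divide_distrib)
      also have "\<bar>\<dots>\<bar> \<le> (1 / ?q r) * \<bar>?d ?v\<bar>
          + (of_bool (u 0) + val_at t ?v) * \<bar>1 / ?q t - 1 / ?q r\<bar>"
        using R.p0 R.p1 T.val_nonneg[of ?v]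
        by (intro order_trans[OF abs_triangle_ineq] add_mono) (auto simp: abs_mult)
      also have "\<dots> \<le> R.ratio * \<bar>?d ?v\<bar> + ?k t"
      proof (intro add_mono)
        show "(1 / ?q r) * \<bar>?d ?v\<bar> \<le> R.ratio * \<bar>?d ?v\<bar>"
          using R.ratio by (intro mult_right_mono) auto
        have "(of_bool (u 0) + val_at t ?v) * \<bar>1 / ?q t - 1 / ?q r\<bar>
            \<le> (1 + T.vmax) * (\<bar>1 / p0 powr t - 1 / p0 powr r\<bar> + \<bar>1 / p1 powr t - 1 / p1 powr r\<bar>)"
          using T.val_nonneg[of ?v] T.val_le_vmax[of ?v] by (intro mult_mono) auto
        then show "(of_bool (u 0) + val_at t ?v) * \<bar>1 / ?q t - 1 / ?q r\<bar> \<le> ?k t"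
          by (simp add: T.vmax_def mult.commute)
      qed
      finally show "\<exists>v\<in>UNIV. \<bar>?d u\<bar> \<le> R.ratio * max 0 \<bar>?d v\<bar> + ?k t" by auto
    qed (use R.ratio k in auto)
    then show ?case using elim(1) by (meson less_imp_le order_trans)
  qed
qed

text \<open>Unless all exponents are separated, \<open>s\<close> is the infimum of the separated ones.  It is not separated itself, because
separation is an open condition; hence it is covering.  As a limit of separated exponents it still
separates weakly, so \<open>\<pi>\<^sub>s(a) \<le> \<pi>\<^sub>s(b)\<close>, and a strict inequality would make it separated.\<close>
theorem critical_exponent:
  assumes ab: "(a, b) \<in> admissible_pairs"
  obtains (separated) "\<And>r. 0 < r \<Longrightarrow> separated_at r (Omega a b)"
    | (critical) s where "0 < s" "val_at s a = val_at s b"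
        "\<And>r. 0 < r \<Longrightarrow> r \<le> s \<Longrightarrow> covering_at r (Omega a b)"
        "\<And>r. s < r \<Longrightarrow> separated_at r (Omega a b)"
proof -
  let ?X = "Omega a b"
  define R where "R = {r. 0 < r \<and> separated_at r ?X}"
  have dich: "covering_at r ?X" if "0 < r" "r \<notin> R" for r
    using two_bases.separated_or_covering[OF two_bases_powr ab] that by (auto simp: R_def)
  have up: "t \<in> R" if "r \<in> R" "r < t" for r t
    using that dich[of t] separated_at_not_covering_at[of r t ?X] shift_closed_Omega
    by (auto simp: R_def)
  \<comment> \<open>For large exponents already the two words of length 1 have too little weight.\<close>
  have "R \<noteq> {}"
  proof
    assume "R = {}"
    then have cov: "covering_at r ?X" if "0 < r" for r using dich that by blast
    have "1 / 2 \<le> ratio ^ k * weight_sum_at 1 ?X 1" if "0 < k" for k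
      using weight_sum_at_decay[of 1 "1 + real k" ?X 1] that ratio
        two_bases.covering_weight_sum_ge[OF two_bases_powr cov, of "1 + real k" 1]
      by (simp add: powr_realpow)
    moreover have "(\<lambda>k. ratio ^ k * weight_sum_at 1 ?X 1) \<longlonglongrightarrow> 0 * weight_sum_at 1 ?X 1"
      using ratio by (intro tendsto_intros) auto
    ultimately have "1 / 2 \<le> 0 * weight_sum_at 1 ?X 1"
      by (intro LIMSEQ_le_const) (auto intro!: exI[of _ 1] simp del: mult_zero_left)
    then show False by simp
  qed
  show thesis
  proof (cases "\<forall>r>0. r \<in> R")
    case True
    then show thesis using separated by (simp add: R_def)
  next
    case False
    then obtain r0 where r0: "0 < r0" "r0 \<notin> R" by blast
    then have lower: "r0 \<le> r" if "r \<in> R" for r using up[OF that, of r0] by force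
    define s where "s = Inf R"
    have bdd: "bdd_below R" using lower by (rule bdd_belowI)
    have s: "0 < s" using r0 cInf_greatest[OF \<open>R \<noteq> {}\<close>, of r0] lower by (force simp: s_def)
    have above: "r \<in> R" if "s < r" for r
      using that cInf_lessD[OF \<open>R \<noteq> {}\<close>, of r] up by (auto simp: s_def)
    have below: "s \<le> r" if "r \<in> R" for r using that bdd by (simp add: s_def cInf_lower)
    interpret S: two_bases "p0 powr s" "p1 powr s" by (rule two_bases_powr[OF s])
    have "s \<notin> R"
    proof
      assume "s \<in> R"
      then obtain d where d: "0 < d"
        and gap: "\<And>u v. u \<in> ?X \<Longrightarrow> v \<in> ?X \<Longrightarrow> \<not> u 0 \<Longrightarrow> v 0 \<Longrightarrow> val_at s u + d \<le> val_at s v"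
        unfolding R_def mem_Collect_eq S.separated_def by blast
      have "\<forall>\<^sub>F t in at_left s. \<forall>u. \<bar>val_at t u - val_at s u\<bar> \<le> d / 3"
        using val_at_uniformly_continuous[OF s, of "d / 3"] d by (simp add: eventually_at_split)
      moreover have "\<forall>\<^sub>F t in at_left s. 0 < t"
        using s by (rule order_tendstoD[OF tendsto_ident_at])
      moreover have "\<forall>\<^sub>F t in at_left s. t < s" by (simp add: eventually_at_filter)
      ultimately have "\<forall>\<^sub>F t in at_left s. t \<in> R \<and> t < s"
      proof eventually_elim
        case (elim t)
        interpret T: two_bases "p0 powr t" "p1 powr t" by (rule two_bases_powr[OF elim(2)])
        have "val_at t u + d / 3 \<le> val_at t v" if "u \<in> ?X" "v \<in> ?X" "\<not> u 0" "v 0" for u v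
          using gap[OF that] elim(1)[rule_format, of u] elim(1)[rule_format, of v]
          by (simp only: abs_le_iff) (simp add: field_simps)
        then have "T.separated ?X" unfolding T.separated_def using d by (intro exI[of _ "d / 3"]) auto
        then show ?case using elim by (simp add: R_def)
      qed
      then obtain t where "t \<in> R" "t < s"
        using eventually_happens[of _ "at_left s"] by (auto simp: trivial_limit_at_left_real)
      then show False using below by force
    qed
    have weak: "val_at s u \<le> val_at s v" if "u \<in> ?X" "v \<in> ?X" "\<not> u 0" "v 0" for u v
    proof (rule ccontr)
      assume "\<not> val_at s u \<le> val_at s v"
      define d where "d = val_at s u - val_at s v"
      have d: "0 < d" using \<open>\<not> val_at s u \<le> val_at s v\<close> by (simp add: d_def)
      have "\<forall>\<^sub>F t in at_right s. \<forall>u. \<bar>val_at t u - val_at s u\<bar> \<le> d / 3"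
        using val_at_uniformly_continuous[OF s, of "d / 3"] d by (simp add: eventually_at_split)
      moreover have "\<forall>\<^sub>F t in at_right s. s < t" by (rule eventually_at_right_less)
      ultimately have "\<forall>\<^sub>F t in at_right s. False"
      proof eventually_elim
        case (elim t)
        then have "t \<in> R" using above by simp
        then have "0 < t" "separated_at t ?X" by (auto simp: R_def)
        then have "val_at t u < val_at t v"
          using that unfolding two_bases.separated_def[OF two_bases_powr[OF \<open>0 < t\<close>]] by force
        then show False
          using elim(1)[rule_format, of u] elim(1)[rule_format, of v] d
          unfolding d_def abs_le_iff by argo
      qed
      then show False by (simp add: trivial_limit_at_right_real)
    qed
    have mem: "a \<in> ?X" "b \<in> ?X" "\<not> a 0" "b 0" using ab by (auto simp: admissible_pairs_def)
    have "\<not> val_at s a < val_at s b"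
      using S.separatedI[OF ab weak] \<open>s \<notin> R\<close> s by (auto simp: R_def)
    then have "val_at s a = val_at s b" using weak[OF mem] by simp
    moreover have "covering_at r ?X" if "0 < r" "r \<le> s" for r
      using dich[OF that(1)] below[of r] \<open>s \<notin> R\<close> that(2) by force
    ultimately show thesis using critical s above by (auto simp: R_def)
  qed
qed

lemma separated_at_less:
  assumes "(a, b) \<in> admissible_pairs" "0 < r" "separated_at r (Omega a b)"
  shows "val_at r a < val_at r b"
proof -
  interpret R: two_bases "p0 powr r" "p1 powr r" by (rule two_bases_powr[OF assms(2)])
  show ?thesis using assms unfolding R.separated_def admissible_pairs_def by force
qed

end

section \<open>Hausdorff measure and dimension\<close>

lemma hausdorff_pre_measure_le_finite:
  fixes A :: "'a :: metric_space set"
  assumes I: "finite I" and cover: "A \<subseteq> (\<Union>i\<in>I. V i)" and "0 \<le> \<delta>" "0 < t"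
    and V: "\<And>i. i \<in> I \<Longrightarrow> bounded (V i) \<and> diameter (V i) \<le> d i \<and> d i \<le> \<delta>"
  shows "hausdorff_pre_measure t \<delta> A \<le> ennreal (\<Sum>i\<in>I. d i powr t)"
proof -
  obtain f where f: "bij_betw f {0..<card I} I" using ex_bij_betw_nat_finite[OF I] by blast
  define U where "U k = (if k < card I then V (f k) else {})" for k
  have fI: "f k \<in> I" if "k < card I" for k using f that by (auto simp: bij_betw_def)
  have "A \<subseteq> (\<Union>k. U k)"
  proof
    fix x assume "x \<in> A"
    then obtain i where "i \<in> I" "x \<in> V i" using cover by blast
    moreover then obtain k where "k < card I" "f k = i" using f by (force simp: bij_betw_def)
    ultimately show "x \<in> (\<Union>k. U k)" by (auto simp: U_def)
  qed
  moreover have "bounded (U k) \<and> diameter (U k) \<le> \<delta>" for k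
    using V fI[of k] \<open>0 \<le> \<delta>\<close> order_trans by (auto simp: U_def)
  ultimately have "hausdorff_pre_measure t \<delta> A \<le> (\<Sum>k. ennreal (diam_powr (U k) t))"
    unfolding hausdorff_pre_measure_def by (intro INF_lower) auto
  also have "\<dots> = (\<Sum>k\<in>{0..<card I}. ennreal (diam_powr (U k) t))"
    by (intro suminf_finite) (auto simp: U_def diam_powr_def)
  also have "\<dots> \<le> (\<Sum>k\<in>{0..<card I}. ennreal (d (f k) powr t))"
  proof (intro sum_mono ennreal_leI)
    fix k assume k: "k \<in> {0..<card I}"
    then have "bounded (U k)" "diameter (U k) \<le> d (f k)" using V fI by (auto simp: U_def)
    then show "diam_powr (U k) t \<le> d (f k) powr t"
      using \<open>0 < t\<close> diameter_ge_0[of "U k"] by (auto simp: diam_powr_def intro: powr_mono2)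
  qed
  also have "\<dots> = (\<Sum>i\<in>I. ennreal (d i powr t))"
    using f by (rule sum.reindex_bij_betw)
  finally show ?thesis by (simp add: sum_ennreal)
qed

lemma hausdorff_measure_eq_0I:
  fixes A :: "'a :: metric_space set"
  assumes "\<And>n. finite (I n)" "\<And>n. A \<subseteq> (\<Union>i\<in>I n. V n i)" "0 < t"
    and V: "\<And>n i. i \<in> I n \<Longrightarrow> bounded (V n i) \<and> diameter (V n i) \<le> d n i \<and> d n i \<le> \<epsilon> n"
    and \<epsilon>: "\<epsilon> \<longlonglongrightarrow> 0" and sum: "(\<lambda>n. \<Sum>i\<in>I n. d n i powr t) \<longlonglongrightarrow> 0"
  shows "hausdorff_measure t A = 0"
proof -
  have "hausdorff_pre_measure t \<delta> A \<le> 0" if "0 < \<delta>" for \<delta>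
  proof -
    have "\<forall>\<^sub>F n in sequentially. \<epsilon> n < \<delta>" using \<epsilon> that by (rule order_tendstoD)
    then have "\<forall>\<^sub>F n in sequentially. hausdorff_pre_measure t \<delta> A \<le> ennreal (\<Sum>i\<in>I n. d n i powr t)"
    proof eventually_elim
      case (elim n)
      show ?case
      proof (rule hausdorff_pre_measure_le_finite[OF assms(1) assms(2)])
        show "bounded (V n i) \<and> diameter (V n i) \<le> d n i \<and> d n i \<le> \<delta>" if "i \<in> I n" for i
          using V[OF that] elim by linarith
      qed (use that \<open>0 < t\<close> in auto)
    qed
    moreover have "(\<lambda>n. ennreal (\<Sum>i\<in>I n. d n i powr t)) \<longlonglongrightarrow> ennreal 0"
      by (rule tendsto_ennrealI[OF sum])
    ultimately show ?thesis
      by (intro tendsto_lowerbound[of _ _ sequentially]) auto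
  qed
  then show ?thesis unfolding hausdorff_measure_def by (intro antisym SUP_least) auto
qed

text \<open>Cover \<open>A\<close> by about \<open>n\<close> intervals of length \<open>T / n\<close>.\<close>
lemma hausdorff_measure_bounded_real:
  fixes A :: "real set"
  assumes A: "A \<subseteq> {0..T}" and t: "1 < t"
  shows "hausdorff_measure t A = 0"
proof (rule hausdorff_measure_eq_0I)
  define N :: "nat \<Rightarrow> real" where "N n = real (Suc n)" for n
  let ?d = "\<lambda>n. \<bar>T\<bar> / N n"
  let ?V = "\<lambda>n i. {real i * ?d n .. real (Suc i) * ?d n}"
  have N: "0 < N n" "1 \<le> N n" for n by (auto simp: N_def)
  \<comment> \<open>The interval with index \<open>Suc n\<close> is needed for the point \<open>T\<close>.\<close>
  show "A \<subseteq> (\<Union>i\<in>{..Suc n}. ?V n i)" for n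
  proof
    fix x assume "x \<in> A"
    then have x: "0 \<le> x" "x \<le> T" using A by auto
    show "x \<in> (\<Union>i\<in>{..Suc n}. ?V n i)"
    proof (cases "T = 0")
      case True
      then show ?thesis using x by auto
    next
      case False
      then have d: "0 < ?d n" using N[of n] x by simp
      define i where "i = nat \<lfloor>x / ?d n\<rfloor>"
      have "real i \<le> x / ?d n" "x / ?d n \<le> real (Suc i)"
        unfolding i_def using x d divide_nonneg_pos[of x "?d n"] by (simp_all only: of_nat_nat of_nat_Suc zero_le_floor) linarith+
      then have "x \<in> ?V n i" using d by (simp only: le_divide_eq divide_le_eq) simp
      moreover have "x / ?d n \<le> N n" using x N[of n] d False by (simp add: field_simps)
      then have "i \<le> Suc n" using \<open>real i \<le> x / ?d n\<close> by (simp add: N_def)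
      ultimately show ?thesis by blast
    qed
  qed
  show "bounded (?V n i) \<and> diameter (?V n i) \<le> ?d n \<and> ?d n \<le> ?d n" for n i
    using N[of n] by (auto simp: diameter_closed_interval add_divide_distrib algebra_simps)
  show "?d \<longlonglongrightarrow> 0"
    unfolding N_def by (rule LIMSEQ_Suc[OF lim_const_over_n])
  have "(\<lambda>n. N n powr (1 - t)) \<longlonglongrightarrow> 0"
    unfolding N_def using t
    by (intro tendsto_neg_powr filterlim_compose[OF filterlim_real_sequentially filterlim_Suc]) auto
  then have "(\<lambda>n. 2 * \<bar>T\<bar> powr t * N n powr (1 - t)) \<longlonglongrightarrow> 2 * \<bar>T\<bar> powr t * 0"
    by (intro tendsto_intros)
  then have lim: "(\<lambda>n. 2 * \<bar>T\<bar> powr t * N n powr (1 - t)) \<longlonglongrightarrow> 0" by simp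
  have "(\<Sum>i\<in>{..Suc n}. ?d n powr t) \<le> 2 * \<bar>T\<bar> powr t * N n powr (1 - t)" for n
  proof -
    have "(\<Sum>i\<in>{..Suc n}. ?d n powr t) = (N n + 1) * (\<bar>T\<bar> powr t / N n powr t)"
      using N[of n] by (simp add: powr_divide N_def)
    also have "\<dots> \<le> (2 * N n) * (\<bar>T\<bar> powr t / N n powr t)"
      using N[of n] by (intro mult_right_mono) auto
    finally show ?thesis using N[of n] by (simp add: powr_diff mult.commute mult.left_commute)
  qed
  then show "(\<lambda>n. \<Sum>i\<in>{..Suc n}. ?d n powr t) \<longlonglongrightarrow> 0"
    by (intro tendsto_sandwich[OF _ _ tendsto_const lim]) (auto intro!: always_eventually sum_nonneg)
qed (use t in auto)

text \<open>A cover of \<open>A\<close> is mapped to a cover of an interval, in which the image of a set of diameter \<open>d\<close> has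
length at most a multiple of \<open>d powr e\<close>; and \<open>d powr e \<le> d powr t\<close> for \<open>d \<le> 1\<close>.\<close>
lemma hausdorff_measure_pos:
  fixes A :: "real set" and g :: "real \<Rightarrow> real"
  assumes K: "0 < K" and T: "0 < T" and t: "0 \<le> t" "t \<le> e" "0 < e"
    and holder: "\<And>x y. x \<in> A \<Longrightarrow> y \<in> A \<Longrightarrow> \<bar>g x - g y\<bar> \<le> K * \<bar>x - y\<bar> powr e"
    and img: "{0..T} \<subseteq> g ` A"
  shows "hausdorff_measure t A \<noteq> 0"
proof -
  have "ennreal (T / (2 * K)) \<le> (\<Sum>i. ennreal (diam_powr (U i) t))"
    if U: "A \<subseteq> (\<Union>i. U i)" "\<And>i. bounded (U i)" "\<And>i. diameter (U i) \<le> 1" for U :: "nat \<Rightarrow> real set"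
  proof -
    define m where "m i = diam_powr (U i) t" for i
    have m0: "0 \<le> m i" for i by (simp add: m_def diam_powr_def)
    have "\<exists>z. g ` (A \<inter> U i) \<subseteq> {z - K * m i .. z + K * m i}" for i
    proof (cases "A \<inter> U i = {}")
      case False
      then obtain x where x: "x \<in> A" "x \<in> U i" by blast
      have "\<bar>g y - g x\<bar> \<le> K * m i" if y: "y \<in> A" "y \<in> U i" for y
      proof -
        have "\<bar>y - x\<bar> \<le> diameter (U i)"
          using diameter_bounded_bound[OF U(2) y(2) x(2)] by (simp add: dist_real_def)
        then have "\<bar>y - x\<bar> powr e \<le> diameter (U i) powr e"
          using t by (intro powr_mono2) auto
        also have "\<dots> \<le> m i"
        proof (cases "t = 0")
          case True
          then show ?thesis using x t U(3)[of i] diameter_ge_0[OF U(2)[of i]]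
            by (auto simp: m_def diam_powr_def intro: powr_le1)
        next
          case False
          then show ?thesis
            using x t U(3)[of i] diameter_ge_0[OF U(2)[of i]]
            by (auto simp: m_def diam_powr_def intro: powr_mono')
        qed
        finally show ?thesis
          using holder[OF y(1) x(1)] K by (meson mult_left_mono less_imp_le order_trans)
      qed
      then have "g ` (A \<inter> U i) \<subseteq> {g x - K * m i .. g x + K * m i}"
        by (auto simp: abs_le_iff) (smt (verit))+
      then show ?thesis by blast
    qed simp
    then obtain z where z: "\<And>i. g ` (A \<inter> U i) \<subseteq> {z i - K * m i .. z i + K * m i}" by metis
    have "{0..T} \<subseteq> (\<Union>i. {z i - K * m i .. z i + K * m i})"
    proof
      fix y assume "y \<in> {0..T}"
      then obtain x where x: "x \<in> A" "y = g x" using img by blast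
      then obtain i where "x \<in> U i" using U(1) by blast
      then have "y \<in> g ` (A \<inter> U i)" using x by blast
      then show "y \<in> (\<Union>i. {z i - K * m i .. z i + K * m i})" using z by blast
    qed
    then have "emeasure lborel {0..T} \<le> emeasure lborel (\<Union>i. {z i - K * m i .. z i + K * m i})"
      by (intro emeasure_mono) auto
    also have "\<dots> \<le> (\<Sum>i. emeasure lborel {z i - K * m i .. z i + K * m i})"
      by (intro emeasure_subadditive_countably) auto
    also have "\<dots> = (\<Sum>i. ennreal (2 * K) * ennreal (m i))"
      using K m0 by (intro suminf_cong) (simp add: emeasure_lborel_Icc_eq ennreal_mult'[symmetric])
    also have "\<dots> = ennreal (2 * K) * (\<Sum>i. ennreal (m i))" by simp
    finally have "ennreal T \<le> ennreal (2 * K) * (\<Sum>i. ennreal (m i))" using T by simp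
    then have "ennreal (1 / (2 * K)) * ennreal T
        \<le> ennreal (1 / (2 * K)) * (ennreal (2 * K) * (\<Sum>i. ennreal (m i)))"
      by (intro mult_left_mono) auto
    also have "\<dots> = ennreal (1 / (2 * K) * (2 * K)) * (\<Sum>i. ennreal (m i))"
      using K by (subst ennreal_mult) (auto simp: mult.assoc)
    also have "\<dots> = (\<Sum>i. ennreal (m i))" using K by simp
    finally show ?thesis using K T by (simp add: ennreal_mult'[symmetric] m_def)
  qed
  then have "ennreal (T / (2 * K)) \<le> hausdorff_pre_measure t 1 A"
    unfolding hausdorff_pre_measure_def by (intro INF_greatest) auto
  also have "\<dots> \<le> hausdorff_measure t A"
    unfolding hausdorff_measure_def by (intro SUP_upper) auto
  finally show ?thesis using K T by auto
qed

lemma hausdorff_dim_eqI: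
  fixes A :: "'a :: metric_space set"
  assumes "0 \<le> d" and above: "\<And>t. d < t \<Longrightarrow> hausdorff_measure t A = 0"
    and below: "\<And>t. 0 \<le> t \<Longrightarrow> t < d \<Longrightarrow> hausdorff_measure t A \<noteq> 0"
  shows "hausdorff_dim A = ereal d"
proof (rule antisym)
  have "hausdorff_dim A \<le> ereal (d + e)" if "0 < e" for e
    unfolding hausdorff_dim_def
    by (rule INF_lower) (use that above[of "d + e"] \<open>0 \<le> d\<close> in simp)
  then show "hausdorff_dim A \<le> ereal d"
    by (metis ereal_le_epsilon2 plus_ereal.simps(1))
  have "d \<le> t" if "0 \<le> t" "hausdorff_measure t A = 0" for t
    using below[of t] that by (cases "t < d") auto
  then show "ereal d \<le> hausdorff_dim A"
    unfolding hausdorff_dim_def by (intro INF_greatest) simp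
qed

context two_bases
begin

section \<open>Hausdorff dimension of the image\<close>

text \<open>The images of the cylinders of length \<open>n\<close> have diameter at most a multiple of their weights, so the
weight sum at \<open>t\<close> bounds the cost of the cover that they form.\<close>
lemma hausdorff_measure_image_eq_0:
  assumes t: "0 < t" and lim: "weight_sum_at t X \<longlonglongrightarrow> 0"
  shows "hausdorff_measure t (val ` X) = 0"
proof (rule hausdorff_measure_eq_0I[where I = "prefixes X" and V = "\<lambda>n w. val ` cylinder X w"
      and d = "\<lambda>n w. weight w * vmax" and \<epsilon> = "\<lambda>n. ratio ^ n * vmax"])
  show "val ` X \<subseteq> (\<Union>w\<in>prefixes X n. val ` cylinder X w)" for n
  proof
    fix z assume "z \<in> val ` X"
    then obtain u where u: "u \<in> X" "z = val u" by blast
    then have "u \<in> cylinder X (prefix_of u n)" by (simp add: cylinder_def)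
    moreover from this have "prefix_of u n \<in> prefixes X n" by (auto simp: in_prefixes_iff)
    ultimately show "z \<in> (\<Union>w\<in>prefixes X n. val ` cylinder X w)" using u by blast
  qed
  show "bounded (val ` cylinder X w) \<and> diameter (val ` cylinder X w) \<le> weight w * vmax
      \<and> weight w * vmax \<le> ratio ^ n * vmax" if "w \<in> prefixes X n" for n w
  proof (intro conjI)
    show "bounded (val ` cylinder X w)"
      by (rule bounded_subset[OF bounded_closed_interval[of 0 vmax]])
         (use val_nonneg val_le_vmax in auto)
    have "\<bar>val u - val v\<bar> \<le> weight w * vmax" if "u \<in> cylinder X w" "v \<in> cylinder X w" for u v
    proof -
      have u: "prefix_of u (length w) = w" and v: "prefix_of v (length w) = w"
        using that by (simp_all only: cylinder_def mem_Collect_eq)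
      then have "prefix_of u (length w) = prefix_of v (length w)" by (simp only:)
      from val_diff_le[OF this] show ?thesis unfolding u .
    qed
    then show "diameter (val ` cylinder X w) \<le> weight w * vmax"
      using weight_pos[of w] vmax_pos by (intro diameter_le) auto
    show "weight w * vmax \<le> ratio ^ n * vmax"
      using weight_le_power[of w] vmax_pos that by (intro mult_right_mono) (auto simp: in_prefixes_iff)
  qed
  show "(\<lambda>n. ratio ^ n * vmax) \<longlonglongrightarrow> 0"
    using ratio by (intro tendsto_mult_left_zero LIMSEQ_power_zero) auto
  have "(\<Sum>w\<in>prefixes X n. (weight w * vmax) powr t) = vmax powr t * weight_sum_at t X n" for n
    using t weight_pos vmax_pos
    by (simp add: weight_sum_at_eq powr_mult less_imp_le sum_distrib_left mult.commute)
  then show "(\<lambda>n. \<Sum>w\<in>prefixes X n. (weight w * vmax) powr t) \<longlonglongrightarrow> 0"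
    using tendsto_mult_right_zero[OF lim] by simp
qed (use t in auto)

lemma hausdorff_measure_covering:
  assumes "covering X" "0 \<le> t" "t \<le> 1"
  shows "hausdorff_measure t (val ` X) \<noteq> 0"
  by (rule hausdorff_measure_pos[where g = "\<lambda>x. x" and K = 1 and e = 1 and T = vmax])
     (use assms vmax_pos in \<open>auto simp: covering_def\<close>)

text \<open>Two sequences whose common prefix is \<open>w\<close> have values at least \<open>\<delta> * weight w\<close> apart, while their
values at exponent \<open>s\<close> are at most a multiple of \<open>weight w powr s\<close> apart.  So the value at \<open>s\<close> is a
Hoelder continuous function of the value, and it ranges over an interval.\<close>
lemma hausdorff_measure_separated:
  assumes X: "shift_closed X" "separated X" and s: "0 < s" "covering_at s X" and t: "0 \<le> t" "t \<le> s"
  shows "hausdorff_measure t (val ` X) \<noteq> 0"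
proof -
  interpret S: two_bases "p0 powr s" "p1 powr s" by (rule two_bases_powr[OF s(1)])
  obtain \<delta> where \<delta>: "0 < \<delta>"
    and gap: "\<And>u v. u \<in> X \<Longrightarrow> v \<in> X \<Longrightarrow> \<not> u 0 \<Longrightarrow> v 0 \<Longrightarrow> val u + \<delta> \<le> val v"
    using X(2) unfolding separated_def by blast
  define K where "K = S.vmax / \<delta> powr s"
  have K: "0 < K" using S.vmax_pos \<delta> by (simp add: K_def)
  have less: "\<bar>val_at s u - val_at s v\<bar> \<le> K * \<bar>val u - val v\<bar> powr s"
    if uv: "u \<in> X" "v \<in> X" "less_fun u v" for u v
  proof -
    obtain n where n: "\<not> u n" "v n" "\<And>k. k < n \<Longrightarrow> u k = v k"
      using uv(3) unfolding less_fun_bool by blast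
    define w where "w = prefix_of u n"
    have "val (shift n u) + \<delta> \<le> val (shift n v)"
      using X(1) uv n by (intro gap) (auto simp: shift_closed_def)
    then have "weight w * \<delta> \<le> weight w * \<bar>val (shift n u) - val (shift n v)\<bar>"
      using weight_pos[of w] by (intro mult_left_mono) auto
    also have "\<dots> = \<bar>val u - val v\<bar>"
      using val_diff[of n u v] n(3) weight_pos[of w] by (simp add: w_def abs_mult)
    finally have "weight w \<le> \<bar>val u - val v\<bar> / \<delta>" using \<delta> by (simp add: le_divide_eq)
    then have "weight w powr s \<le> (\<bar>val u - val v\<bar> / \<delta>) powr s"
      using s weight_pos[of w] by (intro powr_mono2) auto
    then have "weight w powr s * S.vmax \<le> (\<bar>val u - val v\<bar> / \<delta>) powr s * S.vmax"
      using S.vmax_pos by (intro mult_right_mono) auto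
    moreover have "prefix_of u n = prefix_of v n"
      using n(3) unfolding prefix_of_eq_iff by blast
    from S.val_diff_le[OF this] have "\<bar>val_at s u - val_at s v\<bar> \<le> weight w powr s * S.vmax"
      unfolding weight_powr w_def .
    ultimately have "\<bar>val_at s u - val_at s v\<bar> \<le> (\<bar>val u - val v\<bar> / \<delta>) powr s * S.vmax"
      by linarith
    then show ?thesis using \<delta> by (simp add: K_def powr_divide mult.commute)
  qed
  have holder: "\<bar>val_at s u - val_at s v\<bar> \<le> K * \<bar>val u - val v\<bar> powr s"
    if "u \<in> X" "v \<in> X" for u v
    using less_fun_linear[of u v] less[of u v] less[of v u] that
    by (auto simp: abs_minus_commute)
  let ?g = "\<lambda>x. val_at s (inv_into X val x)"
  have inv: "inv_into X val x \<in> X" "val (inv_into X val x) = x" if "x \<in> val ` X" for x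
    using inv_into_into[OF that] f_inv_into_f[OF that] by blast+
  show ?thesis
  proof (rule hausdorff_measure_pos[where g = ?g and K = K and e = s and T = S.vmax])
    show "\<bar>?g x - ?g y\<bar> \<le> K * \<bar>x - y\<bar> powr s" if "x \<in> val ` X" "y \<in> val ` X" for x y
      using holder[OF inv(1)[OF that(1)] inv(1)[OF that(2)]] inv(2)[OF that(1)] inv(2)[OF that(2)]
      by simp
    show "{0..S.vmax} \<subseteq> ?g ` (val ` X)"
    proof
      fix z assume "z \<in> {0..S.vmax}"
      then obtain u where u: "u \<in> X" "z = val_at s u" using s(2) unfolding S.covering_def by blast
      then have "\<bar>val_at s u - ?g (val u)\<bar> \<le> K * 0 powr s"
        using holder[OF u(1) inv(1)[of "val u"]] inv(2)[of "val u"] by auto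
      then have "z = ?g (val u)" using u s by simp
      then show "z \<in> ?g ` (val ` X)" using u by blast
    qed
  qed (use K S.vmax_pos t s in auto)
qed

text \<open>The exponent \<open>r\<close> in the proof is chosen such that the smallest weight of a word of length \<open>n\<close> in the
bases \<open>p0\<close>, \<open>p1\<close>, raised to \<open>r\<close>, equals the largest one in the bases \<open>q0\<close>, \<open>q1\<close>, raised to \<open>s\<close>.  So
the weight sums at \<open>s\<close> of the latter decay along with those at \<open>r\<close> of the former.\<close>
lemma separated_all_not_covering:
  assumes sep: "\<And>r. 0 < r \<Longrightarrow> separated_at r X" and X: "shift_closed X"
    and q: "two_bases q0 q1" "0 < s"
  shows "\<not> two_bases.covering (q0 powr s) (q1 powr s) X"
proof
  interpret Q: two_bases q0 q1 by (rule q(1))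
  assume cov: "Q.covering_at s X"
  define m where "m = min (1 / p0) (1 / p1)"
  have m: "0 < m" "m < 1" "m \<le> 1 / p0" "m \<le> 1 / p1" using p0 p1 by (auto simp: m_def min_def)
  have weight_ge: "m ^ length w \<le> weight w" for w
  proof (induction w)
    case (Cons d w)
    have "m * m ^ length w \<le> (1 / (if d then p1 else p0)) * weight w"
      using Cons m p0 p1 by (intro mult_mono) auto
    then show ?case by simp
  qed simp
  define r where "r = s * ln Q.ratio / ln m"
  have r: "0 < r" using q m Q.ratio by (auto simp: r_def zero_less_divide_iff mult_pos_neg)
  have "m powr r = Q.ratio powr s"
    using m Q.ratio by (simp add: powr_def r_def)
  have "Q.weight_sum_at s X n \<le> weight_sum_at r X n" for n
  proof -
    have "Q.weight w powr s \<le> weight w powr r" if "w \<in> prefixes X n" for w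
    proof -
      have "Q.weight w powr s \<le> (Q.ratio ^ n) powr s"
        using q Q.weight_le_power[of w] Q.weight_pos[of w] that
        by (intro powr_mono2) (auto simp: in_prefixes_iff)
      also have "\<dots> = (Q.ratio powr s) ^ n"
        using Q.ratio by (simp add: powr_realpow[symmetric] powr_powr mult.commute)
      also have "\<dots> = (m ^ n) powr r"
        using m by (simp add: \<open>m powr r = Q.ratio powr s\<close>[symmetric] powr_realpow[symmetric] powr_powr mult.commute)
      also have "\<dots> \<le> weight w powr r"
        using r m weight_ge[of w] that by (intro powr_mono2) (auto simp: in_prefixes_iff)
      finally show ?thesis .
    qed
    then show ?thesis using q r by (simp add: weight_sum_at_eq Q.weight_sum_at_eq sum_mono)
  qed
  moreover have "1 / 2 \<le> Q.weight_sum_at s X n" for n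
    by (rule two_bases.covering_weight_sum_ge[OF Q.two_bases_powr[OF q(2)] cov])
  ultimately have "1 / 2 \<le> weight_sum_at r X n" for n using order_trans by blast
  moreover have "weight_sum_at r X \<longlonglongrightarrow> 0"
    using r by (intro separated_at_decay[of "r / 2"] sep X) auto
  ultimately have "1 / 2 \<le> (0 :: real)" by (intro LIMSEQ_le_const) auto
  then show False by simp
qed

lemma hausdorff_dim_separated:
  assumes X: "shift_closed X" and sep: "\<And>r. 0 < r \<Longrightarrow> separated_at r X"
  shows "hausdorff_dim (val ` X) = 0"
proof -
  have "hausdorff_measure t (val ` X) = 0" if "0 < t" for t
    using that X by (intro hausdorff_measure_image_eq_0 separated_at_decay[of "t / 2"] sep) auto
  then have "hausdorff_dim (val ` X) = ereal 0" by (intro hausdorff_dim_eqI) auto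
  then show ?thesis by simp
qed

lemma hausdorff_dim_critical:
  assumes X: "shift_closed X" and s: "0 < s"
    and cov: "\<And>r. 0 < r \<Longrightarrow> r \<le> s \<Longrightarrow> covering_at r X"
    and sep: "\<And>r. s < r \<Longrightarrow> separated_at r X"
  shows "hausdorff_dim (val ` X) = ereal (min 1 s)"
proof (rule hausdorff_dim_eqI)
  fix t assume t: "min 1 s < t"
  show "hausdorff_measure t (val ` X) = 0"
  proof (cases "s < t")
    case True
    then show ?thesis
      using s X by (intro hausdorff_measure_image_eq_0 separated_at_decay[of "(s + t) / 2"] sep) auto
  next
    case False
    then have "1 < t" using t by auto
    then show ?thesis
      using val_nonneg val_le_vmax by (intro hausdorff_measure_bounded_real[of _ vmax]) auto
  qed
next
  have one: "p0 powr 1 = p0" "p1 powr 1 = p1" using p0 p1 by auto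
  fix t assume t: "0 \<le> t" "t < min 1 s"
  show "hausdorff_measure t (val ` X) \<noteq> 0"
  proof (cases "1 \<le> s")
    case True
    then show ?thesis using cov[of 1] t unfolding one by (intro hausdorff_measure_covering) auto
  next
    case False
    then have "separated X" using sep[of 1] unfolding one by simp
    then show ?thesis
      using hausdorff_measure_separated[OF X _ s cov[OF s order_refl]] t by auto
  qed
qed (use s in simp)

end

section \<open>Topological entropy\<close>

lemma has_topological_entropyI:
  assumes c: "0 < c" "\<And>n. c * exp (h * real n) \<le> real (card (prefixes X n))"
    and C: "\<And>r. h < r \<Longrightarrow> \<exists>C>0. \<forall>n. real (card (prefixes X n)) \<le> C * exp (r * real n)"
  shows "has_topological_entropy X h"
  unfolding has_topological_entropy_def
proof (rule order_tendstoI)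
  fix l assume "l < h"
  have "(\<lambda>n. h + ln c / real n) \<longlonglongrightarrow> h + 0"
    by (intro tendsto_intros lim_const_over_n)
  then have "\<forall>\<^sub>F n in sequentially. l < h + ln c / real n"
    using \<open>l < h\<close> by (intro order_tendstoD(1)) auto
  moreover have "\<forall>\<^sub>F n in sequentially. 0 < n" by (rule eventually_gt_at_top)
  ultimately show "\<forall>\<^sub>F n in sequentially. l < ln (real (card (prefixes X n))) / real n"
  proof eventually_elim
    case (elim n)
    have "ln c + h * real n = ln (c * exp (h * real n))" using c by (simp add: ln_mult)
    also have "\<dots> \<le> ln (real (card (prefixes X n)))"
      using c(1) c(2)[of n] by (intro ln_mono) auto
    finally have "(ln c + h * real n) / real n \<le> ln (real (card (prefixes X n))) / real n"
      by (intro divide_right_mono) auto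
    then show ?case using elim by (simp add: add_divide_distrib)
  qed
next
  fix l assume "h < l"
  then obtain r where r: "h < r" "r < l" using dense by blast
  obtain C where C: "0 < C" "\<And>n. real (card (prefixes X n)) \<le> C * exp (r * real n)"
    using C[OF r(1)] by blast
  have "(\<lambda>n. r + ln C / real n) \<longlonglongrightarrow> r + 0"
    by (intro tendsto_intros lim_const_over_n)
  then have "\<forall>\<^sub>F n in sequentially. r + ln C / real n < l"
    using r by (intro order_tendstoD(2)) auto
  moreover have "\<forall>\<^sub>F n in sequentially. 0 < n" by (rule eventually_gt_at_top)
  ultimately show "\<forall>\<^sub>F n in sequentially. ln (real (card (prefixes X n))) / real n < l"
  proof eventually_elim
    case (elim n)
    have "0 < c * exp (h * real n)" using c(1) by simp
    then have "0 < real (card (prefixes X n))" using c(2)[of n] by (rule less_le_trans)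
    then have "ln (real (card (prefixes X n))) \<le> ln (C * exp (r * real n))"
      using C by (intro ln_mono) auto
    also have "\<dots> = ln C + r * real n" using C by (simp add: ln_mult)
    finally have "ln (real (card (prefixes X n))) / real n \<le> (ln C + r * real n) / real n"
      by (intro divide_right_mono) auto
    then show ?case using elim by (simp add: add_divide_distrib)
  qed
qed

text \<open>In base \<open>e\<close> the weight of a word depends only on its length, and the weight sums count words.\<close>
interpretation natural: two_bases "exp 1" "exp 1"
  by unfold_locales auto

lemma natural_weight_sum_at: "0 < r \<Longrightarrow>
    natural.weight_sum_at r X n = real (card (prefixes X n)) * exp (- r * real n)"
proof -
  have "natural.weight w = exp (- real (length w))" for w
    by (induction w) (auto simp: exp_minus exp_add exp_diff field_simps)
  then have "natural.weight w powr r = exp (- r * real n)" if "w \<in> prefixes X n" for w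
    using that by (simp add: in_prefixes_iff exp_powr_real)
  moreover assume "0 < r"
  ultimately show ?thesis by (simp add: natural.weight_sum_at_eq)
qed

lemma natural_card_prefixes_le:
  assumes "0 < r" "shift_closed X" "natural.separated_at r X"
  shows "\<exists>C>0. \<forall>n. real (card (prefixes X n)) \<le> C * exp (r * real n)"
proof -
  interpret R: two_bases "exp 1 powr r" "exp 1 powr r"
    by (rule natural.two_bases_powr[OF assms(1)])
  obtain C where C: "0 < C" "\<And>n. natural.weight_sum_at r X n \<le> C"
    using R.separated_weight_sum_bounded[OF assms(2,3)] by blast
  then have "real (card (prefixes X n)) \<le> C * exp (r * real n)" for n
    using C(2)[of n] assms(1) by (simp add: natural_weight_sum_at exp_minus field_simps)
  then show ?thesis using C(1) by blast
qed

lemma entropy_separated: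
  assumes "shift_closed X" "X \<noteq> {}" "\<And>r. 0 < r \<Longrightarrow> natural.separated_at r X"
  shows "has_topological_entropy X 0"
proof (rule has_topological_entropyI[where c = 1])
  have "prefixes X n \<noteq> {}" for n using assms(2) by (simp add: prefixes_def)
  then show "1 * exp (0 * real n) \<le> real (card (prefixes X n))" for n
    by (simp add: Suc_le_eq card_gt_0_iff)
qed (use natural_card_prefixes_le assms in auto)

lemma entropy_critical:
  assumes X: "shift_closed X" and s: "0 < s" "natural.covering_at s X"
    and sep: "\<And>r. s < r \<Longrightarrow> natural.separated_at r X"
  shows "has_topological_entropy X s"
proof (rule has_topological_entropyI[where c = "1 / 2"])
  interpret S: two_bases "exp 1 powr s" "exp 1 powr s"
    by (rule natural.two_bases_powr[OF s(1)])
  show "1 / 2 * exp (s * real n) \<le> real (card (prefixes X n))" for n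
    using S.covering_weight_sum_ge[OF s(2), of n] s(1)
    by (simp add: natural_weight_sum_at exp_minus field_simps)
  show "\<exists>C>0. \<forall>n. real (card (prefixes X n)) \<le> C * exp (r * real n)" if "s < r" for r
    using that s by (intro natural_card_prefixes_le X sep) auto
qed simp

lemma natural_val_at: "0 < \<beta> \<Longrightarrow> natural.val_at (ln \<beta>) = double_base_expansion \<beta> \<beta>"
  by (simp add: exp_powr_real)

section \<open>Entropy and dimension of a binary shift with a hole\<close>

theorem theorem1p2:
  fixes a b :: binseq and q0 q1 :: real
  assumes "(a, b) \<in> admissible_pairs" and "q0 > 1" and "q1 > 1"
  shows
    "((\<forall>\<beta>>1. double_base_expansion \<beta> \<beta> a < double_base_expansion \<beta> \<beta> b) \<longrightarrow>
        has_topological_entropy (Omega a b) 0 \<and>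
        hausdorff_dim (double_base_expansion q0 q1 ` Omega a b) = 0)
     \<and>
     (\<not> (\<forall>\<beta>>1. double_base_expansion \<beta> \<beta> a < double_base_expansion \<beta> \<beta> b) \<longrightarrow>
        (\<exists>\<beta>>1. double_base_expansion \<beta> \<beta> a = double_base_expansion \<beta> \<beta> b \<and>
           (\<forall>\<gamma>>1. double_base_expansion \<gamma> \<gamma> a = double_base_expansion \<gamma> \<gamma> b \<longrightarrow> \<gamma> \<le> \<beta>) \<and>
           has_topological_entropy (Omega a b) (ln \<beta>)) \<and>
        (\<exists>s>0. double_base_expansion (q0 powr s) (q1 powr s) a =
                 double_base_expansion (q0 powr s) (q1 powr s) b \<and>
           (\<forall>t>0. double_base_expansion (q0 powr t) (q1 powr t) a =
                    double_base_expansion (q0 powr t) (q1 powr t) b \<longrightarrow> t \<le> s) \<and>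
           hausdorff_dim (double_base_expansion q0 q1 ` Omega a b) = ereal (min 1 s)))"
proof -
  let ?X = "Omega a b"
  interpret Q: two_bases q0 q1 using assms by unfold_locales
  note ab = assms(1)
  have X: "shift_closed ?X" "?X \<noteq> {}"
    using ab by (auto simp: shift_closed_Omega admissible_pairs_def)
  from ab show ?thesis
  proof (cases rule: natural.critical_exponent)
    case separated
    have "double_base_expansion \<beta> \<beta> a < double_base_expansion \<beta> \<beta> b" if "1 < \<beta>" for \<beta>
      using natural.separated_at_less[OF ab _ separated, of "ln \<beta>"] that
      by (simp only: natural_val_at) (simp add: natural_val_at)
    moreover have "has_topological_entropy ?X 0"
      using X separated by (rule entropy_separated)
    moreover from ab have "hausdorff_dim (Q.val ` ?X) = 0"
    proof (cases rule: Q.critical_exponent)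
      case q_separated: separated
      show ?thesis using X(1) q_separated by (rule Q.hausdorff_dim_separated)
    next
      case (critical s)
      then show ?thesis
        using natural.separated_all_not_covering[OF separated X(1) Q.two_bases_axioms, of s] by simp
    qed
    ultimately show ?thesis by blast
  next
    case (critical h)
    note nat = critical
    have h: "1 < exp h" "natural.val_at h = double_base_expansion (exp h) (exp h)"
      using nat(1) by (auto simp: exp_powr_real)
    have eq: "double_base_expansion (exp h) (exp h) a = double_base_expansion (exp h) (exp h) b"
      using nat(2) unfolding h .
    moreover have "\<gamma> \<le> exp h"
      if "1 < \<gamma>" "double_base_expansion \<gamma> \<gamma> a = double_base_expansion \<gamma> \<gamma> b" for \<gamma>
    proof (rule ccontr)
      assume "\<not> \<gamma> \<le> exp h"
      then have "ln (exp h) < ln \<gamma>" using that(1) by (subst ln_less_cancel_iff) auto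
      then have "h < ln \<gamma>" by simp
      then have "natural.val_at (ln \<gamma>) a < natural.val_at (ln \<gamma>) b"
        using nat by (intro natural.separated_at_less[OF ab]) auto
      then show False using that by (simp add: natural_val_at)
    qed
    moreover have "has_topological_entropy ?X (ln (exp h))"
      using entropy_critical[OF X(1) nat(1) nat(3)[OF nat(1) order_refl] nat(4)] by simp
    moreover from ab have "\<exists>s>0. Q.val_at s a = Q.val_at s b
        \<and> (\<forall>t>0. Q.val_at t a = Q.val_at t b \<longrightarrow> t \<le> s)
        \<and> hausdorff_dim (Q.val ` ?X) = ereal (min 1 s)"
    proof (cases rule: Q.critical_exponent)
      case separated
      then show ?thesis
        using Q.separated_all_not_covering[OF separated X(1) natural.two_bases_axioms nat(1)] nat by simp
    next
      case (critical s)
      have "t \<le> s" if "0 < t" "Q.val_at t a = Q.val_at t b" for t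
      proof (rule ccontr)
        assume "\<not> t \<le> s"
        then have "Q.val_at t a < Q.val_at t b"
          using critical that by (intro Q.separated_at_less[OF ab]) auto
        then show False using that by simp
      qed
      then show ?thesis
        using critical Q.hausdorff_dim_critical[OF X(1) critical(1,3,4)] by blast
    qed
    moreover have "\<not> (\<forall>\<beta>>1. double_base_expansion \<beta> \<beta> a < double_base_expansion \<beta> \<beta> b)"
      using h(1) eq by (auto intro!: exI[of _ "exp h"])
    ultimately show ?thesis using h(1) by blast
  qed
qed

end
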